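(* For every $\varepsilon>0$ there exist a reflexive Banach space $\mathcal{B}$ and a closed densely defined operator $A$ on $\mathcal{B}$ such that (i) $\mathrm{Spec}(A)\subseteq i\mathbf{R}$, (ii) $\|(\lambda I-A)^{-1}\|\le(1+\varepsilon)/|\mathrm{Re}(\lambda)|$ for all $\lambda\notin i\mathbf{R}$, (iii) $A$ is not the generator of a one-parameter semigroup.
   Context: A one-parameter semigroup is a strongly continuous semigroup $(T_t)_{t\ge 0}$ of bounded operators on $\mathcal{B}$ with $T_0=I$. Banach spaces are complex. *)

theory Defs
  imports "HOL-Analysis.Analysis" "HOL-Library.Function_Algebras"
begin

text \<open>
  Complex normed spaces are carrier-based, so that one can quantify existentially over them:
  a space consists of a complex scalar multiplication on an ambient abelian group, a linear
  subspace \<open>vecs\<close> and a norm on it.  Only the values of \<open>nrm\<close> on \<open>vecs\<close> matter.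
\<close>

record 'a cspace =
  vecs :: "'a set"
  scl :: "complex \<Rightarrow> 'a \<Rightarrow> 'a"
  nrm :: "'a \<Rightarrow> real"

definition complex_normed_space :: "'a::ab_group_add cspace \<Rightarrow> bool" where
  "complex_normed_space B \<longleftrightarrow>
     vector_space (scl B) \<and> module.subspace (scl B) (vecs B) \<and>
     (\<forall>x\<in>vecs B. 0 \<le> nrm B x) \<and>
     (\<forall>x\<in>vecs B. nrm B x = 0 \<longleftrightarrow> x = 0) \<and>
     (\<forall>x\<in>vecs B. \<forall>y\<in>vecs B. nrm B (x + y) \<le> nrm B x + nrm B y) \<and>
     (\<forall>c. \<forall>x\<in>vecs B. nrm B (scl B c x) = cmod c * nrm B x)"

definition norm_tendsto :: "'a::ab_group_add cspace \<Rightarrow> ('b \<Rightarrow> 'a) \<Rightarrow> 'a \<Rightarrow> 'b filter \<Rightarrow> bool" where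
  "norm_tendsto B f l F \<longleftrightarrow> ((\<lambda>t. nrm B (f t - l)) \<longlongrightarrow> 0) F"

definition norm_Cauchy :: "'a::ab_group_add cspace \<Rightarrow> (nat \<Rightarrow> 'a) \<Rightarrow> bool" where
  "norm_Cauchy B X \<longleftrightarrow> (\<forall>e>0. \<exists>M. \<forall>m\<ge>M. \<forall>n\<ge>M. nrm B (X m - X n) < e)"

definition complex_banach_space :: "'a::ab_group_add cspace \<Rightarrow> bool" where
  "complex_banach_space B \<longleftrightarrow>
     complex_normed_space B \<and>
     (\<forall>X. range X \<subseteq> vecs B \<and> norm_Cauchy B X \<longrightarrow>
          (\<exists>l\<in>vecs B. norm_tendsto B X l sequentially))"

definition linear_on ::
  "'a::ab_group_add set \<Rightarrow> (complex \<Rightarrow> 'a \<Rightarrow> 'a) \<Rightarrow> (complex \<Rightarrow> 'b::ab_group_add \<Rightarrow> 'b) \<Rightarrow> ('a \<Rightarrow> 'b) \<Rightarrow> bool"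
  where
  "linear_on D s1 s2 f \<longleftrightarrow>
     (\<forall>x\<in>D. \<forall>y\<in>D. f (x + y) = f x + f y) \<and> (\<forall>c. \<forall>x\<in>D. f (s1 c x) = s2 c (f x))"

text \<open>
  Continuous dual space.  Functionals are normalised to \<open>0\<close> off the carrier, so that two of them
  are equal as functions iff they agree on the space.
\<close>

definition dual :: "'a::ab_group_add cspace \<Rightarrow> ('a \<Rightarrow> complex) cspace" where
  "dual B =
     \<lparr> vecs = {f. linear_on (vecs B) (scl B) (*) f \<and>
                  (\<exists>C. \<forall>x\<in>vecs B. cmod (f x) \<le> C * nrm B x) \<and>
                  (\<forall>x. x \<notin> vecs B \<longrightarrow> f x = 0)},
       scl = (\<lambda>c f x. c * f x),
       nrm = (\<lambda>f. Sup ((\<lambda>x. cmod (f x)) ` {x \<in> vecs B. nrm B x \<le> 1})) \<rparr>"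

definition canonical_embedding :: "'a::ab_group_add cspace \<Rightarrow> 'a \<Rightarrow> ('a \<Rightarrow> complex) \<Rightarrow> complex" where
  "canonical_embedding B x = (\<lambda>f. if f \<in> vecs (dual B) then f x else 0)"

definition reflexive :: "'a::ab_group_add cspace \<Rightarrow> bool" where
  "reflexive B \<longleftrightarrow> canonical_embedding B ` vecs B = vecs (dual (dual B))"

definition bounded_operator :: "'a::ab_group_add cspace \<Rightarrow> ('a \<Rightarrow> 'a) \<Rightarrow> bool" where
  "bounded_operator B T \<longleftrightarrow>
     T ` vecs B \<subseteq> vecs B \<and> linear_on (vecs B) (scl B) (scl B) T \<and>
     (\<exists>C. \<forall>x\<in>vecs B. nrm B (T x) \<le> C * nrm B x)"

text \<open>The operator norm; meaningful for bounded operators only.\<close>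

definition operator_norm :: "'a::ab_group_add cspace \<Rightarrow> ('a \<Rightarrow> 'a) \<Rightarrow> real" where
  "operator_norm B T = Sup ((\<lambda>x. nrm B (T x)) ` {x \<in> vecs B. nrm B x \<le> 1})"

text \<open>An unbounded operator is given by its domain \<open>D\<close> and a function \<open>A\<close>, relevant only on \<open>D\<close>.\<close>

definition operator_in :: "'a::ab_group_add cspace \<Rightarrow> 'a set \<Rightarrow> ('a \<Rightarrow> 'a) \<Rightarrow> bool" where
  "operator_in B D A \<longleftrightarrow>
     module.subspace (scl B) D \<and> D \<subseteq> vecs B \<and> A ` D \<subseteq> vecs B \<and> linear_on D (scl B) (scl B) A"

definition densely_defined :: "'a::ab_group_add cspace \<Rightarrow> 'a set \<Rightarrow> bool" where
  "densely_defined B D \<longleftrightarrow> (\<forall>x\<in>vecs B. \<forall>e>0. \<exists>d\<in>D. nrm B (x - d) < e)"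

definition closed_operator :: "'a::ab_group_add cspace \<Rightarrow> 'a set \<Rightarrow> ('a \<Rightarrow> 'a) \<Rightarrow> bool" where
  "closed_operator B D A \<longleftrightarrow>
     operator_in B D A \<and>
     (\<forall>X. \<forall>x\<in>vecs B. \<forall>y\<in>vecs B.
        range X \<subseteq> D \<and> norm_tendsto B X x sequentially \<and>
        norm_tendsto B (\<lambda>n. A (X n)) y sequentially \<longrightarrow> x \<in> D \<and> A x = y)"

definition resolvent ::
  "'a::ab_group_add cspace \<Rightarrow> 'a set \<Rightarrow> ('a \<Rightarrow> 'a) \<Rightarrow> complex \<Rightarrow> 'a \<Rightarrow> 'a" where
  "resolvent B D A z = inv_into D (\<lambda>x. scl B z x - A x)"

definition resolvent_set :: "'a::ab_group_add cspace \<Rightarrow> 'a set \<Rightarrow> ('a \<Rightarrow> 'a) \<Rightarrow> complex set" where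
  "resolvent_set B D A =
     {z. bij_betw (\<lambda>x. scl B z x - A x) D (vecs B) \<and> bounded_operator B (resolvent B D A z)}"

definition Spec :: "'a::ab_group_add cspace \<Rightarrow> 'a set \<Rightarrow> ('a \<Rightarrow> 'a) \<Rightarrow> complex set" where
  "Spec B D A = - resolvent_set B D A"

definition one_parameter_semigroup ::
  "'a::ab_group_add cspace \<Rightarrow> (real \<Rightarrow> 'a \<Rightarrow> 'a) \<Rightarrow> bool" where
  "one_parameter_semigroup B T \<longleftrightarrow>
     (\<forall>t\<ge>0. bounded_operator B (T t)) \<and>
     (\<forall>x\<in>vecs B. T 0 x = x) \<and>
     (\<forall>s\<ge>0. \<forall>t\<ge>0. \<forall>x\<in>vecs B. T (s + t) x = T s (T t x)) \<and>
     (\<forall>x\<in>vecs B. \<forall>t\<ge>0. norm_tendsto B (\<lambda>s. T s x) (T t x) (at t within {0..}))"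

text \<open>
  The right-hand side says that \<open>(x, y)\<close> lies in the graph of the operator, so this equates both
  the domain and the values of the infinitesimal generator of \<open>T\<close> with those of the operator.
\<close>

definition generator_of ::
  "'a::ab_group_add cspace \<Rightarrow> (real \<Rightarrow> 'a \<Rightarrow> 'a) \<Rightarrow> 'a set \<Rightarrow> ('a \<Rightarrow> 'a) \<Rightarrow> bool" where
  "generator_of B T D A \<longleftrightarrow>
     (\<forall>x\<in>vecs B. \<forall>y\<in>vecs B.
        norm_tendsto B (\<lambda>h. scl B (1 / complex_of_real h) (T h x - x)) y (at_right 0)
        \<longleftrightarrow> x \<in> D \<and> A x = y)"

end

(* A is the diagonal operator with eigenvalues i j, j natural, on a norm that interpolates between
   two extremes.  In l^2 the resolvent has norm 1 / |Re z|.  In the norm dual to bounded variation the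
   constant is only 1 + pi, since the points 1 / (z - i j) move monotonically along a circle; but there
   exp (pi A), which multiplies the j-th coordinate by (-1)^j, maps an alternating vector of norm 1 to
   a vector of ones of norm N when the dimension is N.  Real interpolation with a small exponent theta
   is exact, so it gives the resolvent constant (1 + pi)^theta, below 1 + epsilon, while exp (pi A) still
   has norm of order N^theta.  The l^2-sum of such finite-dimensional blocks, with N unbounded, is
   reflexive, and a semigroup generated by A would contain the unbounded operator exp (pi A). *)

theory Submission
  imports Defs
begin

section \<open>Spaces normed by finitely supported functionals\<close>

text \<open>The constant 1 itself is out of reach: by the Hille-Yosida theorem the operator would
  then generate a contraction semigroup. So an arbitrarily small loss has to suffice. Interpolation
  takes place on the dual side: a set of finitely supported functionals is fixed and the norm is its
  supremum. One functional then bounds a norm from below, and a resolvent bound becomes invariance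
  of the set. Dilating the interpolation parameter makes this bound exact. The total variation of
  the resolvent multiplier is at most \<open>pi / \<bar>Re z\<bar>\<close> on every interval of
  indices, wherever it lies, so consecutive blocks can share one diagonal operator. Reflexivity uses
  nothing about the norm inside a block, only that blocks are finite-dimensional and that head and
  tail are orthogonal at each block boundary. The space contains every sequence with finite
  supremum, and orthogonality makes truncations converge, in norm, both for vectors and for
  functionals. This is the criterion of James: a boundedly complete and shrinking decomposition
  gives a reflexive space.\<close>

lemma dual_norm_bound:
  assumes B: "complex_normed_space B" and f: "f \<in> vecs (dual B)" and x: "x \<in> vecs B"
  shows "cmod (f x) \<le> nrm (dual B) f * nrm B x"
proof -
  obtain C where C: "\<And>x. x \<in> vecs B \<Longrightarrow> cmod (f x) \<le> C * nrm B x"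
    using f by (auto simp: dual_def)
  have sc: "\<And>c x. x \<in> vecs B \<Longrightarrow> f (scl B c x) = c * f x"
    using f by (auto simp: dual_def linear_on_def)
  have n0: "nrm B x \<ge> 0" "\<And>c. nrm B (scl B c x) = cmod c * nrm B x"
    using B x by (auto simp: complex_normed_space_def)
  have sub: "\<And>c. scl B c x \<in> vecs B"
    using B x module.subspace_scale[of "scl B" "vecs B" x]
    by (simp add: complex_normed_space_def module_iff_vector_space)
  show ?thesis
  proof (cases "nrm B x = 0")
    case True
    then show ?thesis using C[OF x] by simp
  next
    case False
    let ?y = "scl B (of_real (1 / nrm B x)) x"
    have "nrm B ?y \<le> 1" using n0 False by (simp add: norm_divide)
    moreover have "bdd_above ((\<lambda>x. cmod (f x)) ` {x \<in> vecs B. nrm B x \<le> 1})"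
    proof (rule bdd_aboveI2)
      fix y assume "y \<in> {x \<in> vecs B. nrm B x \<le> 1}"
      then have y: "y \<in> vecs B" "nrm B y \<le> 1" "0 \<le> nrm B y"
        using B by (auto simp: complex_normed_space_def)
      have "cmod (f y) \<le> C * nrm B y" using C y by blast
      also have "\<dots> \<le> \<bar>C\<bar> * nrm B y" using y by (intro mult_right_mono) auto
      also have "\<dots> \<le> \<bar>C\<bar> * 1" using y by (intro mult_left_mono) auto
      finally show "cmod (f y) \<le> \<bar>C\<bar>" by simp
    qed
    ultimately have "cmod (f ?y) \<le> nrm (dual B) f"
      using sub by (auto simp: dual_def intro!: cSUP_upper)
    moreover have "f ?y = of_real (1 / nrm B x) * f x" by (rule sc[OF x])
    ultimately have "(1 / nrm B x) * cmod (f x) \<le> nrm (dual B) f"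
      using n0(1) by (simp add: norm_mult norm_divide)
    then show ?thesis using False n0(1) by (simp add: field_simps)
  qed
qed

lemma zero_in_vecs: "complex_normed_space B \<Longrightarrow> 0 \<in> vecs B"
  using module.subspace_0[of "scl B" "vecs B"]
  by (simp add: complex_normed_space_def module_iff_vector_space)

lemma dual_norm_least:
  assumes B: "complex_normed_space B"
    and "\<And>x. x \<in> vecs B \<Longrightarrow> nrm B x \<le> 1 \<Longrightarrow> cmod (f x) \<le> C"
  shows "nrm (dual B) f \<le> C"
proof -
  have "nrm B 0 = 0" using B zero_in_vecs[OF B] by (auto simp: complex_normed_space_def)
  then show ?thesis using zero_in_vecs[OF B] assms(2)
    by (auto simp: dual_def intro!: cSUP_least)
qed

section \<open>Pairing of finitely supported sequences with functions on the naturals\<close>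

definition pair :: "(nat \<Rightarrow> complex) \<Rightarrow> (real \<Rightarrow> complex) \<Rightarrow> complex" where
  "pair \<psi> x = (\<Sum>j | \<psi> j \<noteq> 0. \<psi> j * x (real j))"

lemma pair_eq:
  assumes "finite S" "\<And>j. j \<notin> S \<Longrightarrow> \<psi> j = 0"
  shows "pair \<psi> x = (\<Sum>j\<in>S. \<psi> j * x (real j))"
  unfolding pair_def using assms by (intro sum.mono_neutral_left) auto

lemma pair_add: "pair \<psi> (x + y) = pair \<psi> x + pair \<psi> y"
  by (simp add: pair_def algebra_simps sum.distrib)

lemma pair_diff: "pair \<psi> (x - y) = pair \<psi> x - pair \<psi> y"
  by (simp add: pair_def algebra_simps sum_subtractf)

lemma pair_scale: "pair \<psi> (\<lambda>r. c * x r) = c * pair \<psi> x"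
  by (simp add: pair_def algebra_simps sum_distrib_left)

lemma pair_cmult: "pair (\<lambda>j. c * \<psi> j) x = c * pair \<psi> x"
  by (cases "c = 0") (simp_all add: pair_def algebra_simps sum_distrib_left)

lemma pair_zero: "pair \<psi> 0 = 0"
  by (simp add: pair_def)

definition unit :: "nat \<Rightarrow> real \<Rightarrow> complex" where
  "unit j r = (if r = real j then 1 else 0)"

definition single :: "nat \<Rightarrow> complex \<Rightarrow> nat \<Rightarrow> complex" where
  "single j c i = (if i = j then c else 0)"

lemma pair_single: "pair (single j c) x = c * x (real j)"
  using pair_eq[of "{j}" "single j c" x] by (simp add: single_def)

lemma pair_unit: "finite {i. \<psi> i \<noteq> 0} \<Longrightarrow> pair \<psi> (unit j) = \<psi> j"
proof -
  assume f: "finite {i. \<psi> i \<noteq> 0}"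
  have "pair \<psi> (unit j) = (\<Sum>i\<in>insert j {i. \<psi> i \<noteq> 0}. if i = j then \<psi> i else 0)"
    by (subst pair_eq[of "insert j {i. \<psi> i \<noteq> 0}"])
       (use f in \<open>auto simp: unit_def if_distrib[of "(*) _"] cong: if_cong intro!: sum.cong\<close>)
  also have "\<dots> = \<psi> j" using f by (subst sum.delta) auto
  finally show ?thesis .
qed

lemma unimodular_phase:
  obtains p where "cmod p = 1" "p * z = of_real (cmod z)"
proof (cases "z = 0")
  case True
  then show ?thesis using that[of 1] by simp
next
  case False
  have "cnj z / of_real (cmod z) * z = of_real ((cmod z)\<^sup>2) / of_real (cmod z)"
    unfolding complex_norm_square by simp
  also have "\<dots> = of_real (cmod z)"
    using False by (simp add: power2_eq_square)
  finally show ?thesis using False that[of "cnj z / of_real (cmod z)"] by (simp add: norm_divide)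
qed

lemma le_one_of_sq:
  assumes "0 \<le> a" "0 \<le> b" "a\<^sup>2 + b\<^sup>2 \<le> 1"
  shows "(a::real) \<le> 1" "b \<le> 1"
proof -
  have "a\<^sup>2 \<le> 1\<^sup>2" "b\<^sup>2 \<le> 1\<^sup>2"
    using assms(3) zero_le_power2[of a] zero_le_power2[of b] unfolding one_power2 by linarith+
  then show "a \<le> 1" "b \<le> 1"
    using power2_le_imp_le[of a 1] power2_le_imp_le[of b 1] by simp_all
qed

text \<open>Axioms for a norming set of functionals. \<open>split\<close> and \<open>comb\<close>
  express that a cut at \<open>cut n\<close> behaves like a Euclidean sum; they yield the upper and
  the lower square estimate of the norm. \<open>coord\<close> makes coordinates continuous and the
  norm definite, \<open>bdd\<close> puts the unit vectors into the space.\<close>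

locale norming =
  fixes \<Psi> :: "(nat \<Rightarrow> complex) set" and cut :: "nat \<Rightarrow> nat"
  assumes fin: "\<psi> \<in> \<Psi> \<Longrightarrow> finite {j. \<psi> j \<noteq> 0}"
    and coord: "\<exists>c. c \<noteq> 0 \<and> single j c \<in> \<Psi>"
    and bdd: "\<exists>C. \<forall>\<psi>\<in>\<Psi>. cmod (\<psi> j) \<le> C"
    and split: "\<psi> \<in> \<Psi> \<Longrightarrow> \<exists>a b \<psi>1 \<psi>2. 0 \<le> a \<and> 0 \<le> b \<and> a\<^sup>2 + b\<^sup>2 \<le> 1 \<and> \<psi>1 \<in> \<Psi> \<and> \<psi>2 \<in> \<Psi> \<and>
       (\<forall>j. (if j < cut n then \<psi> j else 0) = complex_of_real a * \<psi>1 j) \<and>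
       (\<forall>j. (if j < cut n then 0 else \<psi> j) = complex_of_real b * \<psi>2 j)"
    and comb: "\<psi>1 \<in> \<Psi> \<Longrightarrow> \<psi>2 \<in> \<Psi> \<Longrightarrow> (cmod a)\<^sup>2 + (cmod b)\<^sup>2 \<le> 1 \<Longrightarrow>
       (\<lambda>j. if j < cut n then a * \<psi>1 j else b * \<psi>2 j) \<in> \<Psi>"
    and mono_cut: "mono cut"
    and cut_unbounded: "\<exists>n. j < cut n"
begin

text \<open>Coordinate \<open>j\<close> sits at \<open>real j\<close>, so that the ambient type is
  the one of the theorem; vanishing off \<open>\<nat>\<close> lets the coordinates determine the
  vector. Only a finite supremum is required, so bounded coordinatewise limits stay in the
  space.\<close>

definition carrier :: "(real \<Rightarrow> complex) set" where
  "carrier = {x. (\<forall>r. r \<notin> \<nat> \<longrightarrow> x r = 0) \<and> (\<exists>C. \<forall>\<psi>\<in>\<Psi>. cmod (pair \<psi> x) \<le> C)}"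

definition nm :: "(real \<Rightarrow> complex) \<Rightarrow> real" where
  "nm x = (SUP \<psi>\<in>\<Psi>. cmod (pair \<psi> x))"

definition space :: "(real \<Rightarrow> complex) cspace" where
  "space = \<lparr> vecs = carrier, scl = (\<lambda>c x r. c * x r), nrm = nm \<rparr>"

lemma space_simps [simp]:
  "vecs space = carrier" "scl space = (\<lambda>c x r. c * x r)" "nrm space = nm"
  by (simp_all add: space_def)

lemma nonempty: "\<Psi> \<noteq> {}"
  using coord by blast

lemma pair_le: "x \<in> carrier \<Longrightarrow> \<psi> \<in> \<Psi> \<Longrightarrow> cmod (pair \<psi> x) \<le> nm x"
  unfolding nm_def carrier_def by (auto intro!: cSUP_upper bdd_aboveI2)

lemma nm_least: "(\<And>\<psi>. \<psi> \<in> \<Psi> \<Longrightarrow> cmod (pair \<psi> x) \<le> C) \<Longrightarrow> nm x \<le> C"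
  unfolding nm_def using nonempty by (auto intro!: cSUP_least)

lemma carrierI:
  "(\<And>r. r \<notin> \<nat> \<Longrightarrow> x r = 0) \<Longrightarrow> (\<And>\<psi>. \<psi> \<in> \<Psi> \<Longrightarrow> cmod (pair \<psi> x) \<le> C) \<Longrightarrow> x \<in> carrier"
  by (auto simp: carrier_def)

lemma carrier_off: "x \<in> carrier \<Longrightarrow> r \<notin> \<nat> \<Longrightarrow> x r = 0"
  by (auto simp: carrier_def)

lemma nm_nonneg: "x \<in> carrier \<Longrightarrow> 0 \<le> nm x"
  using pair_le nonempty norm_ge_zero order_trans by blast

lemma carrier_0: "0 \<in> carrier"
  by (rule carrierI[where C = 0]) (auto simp: pair_zero)

lemma nm_0: "nm 0 = 0"
  using nm_least[of 0 0] nm_nonneg[OF carrier_0] by (simp add: pair_zero)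

lemma carrier_add: "x \<in> carrier \<Longrightarrow> y \<in> carrier \<Longrightarrow> x + y \<in> carrier"
  by (rule carrierI[where C = "nm x + nm y"])
     (auto simp: pair_add carrier_off intro!: norm_triangle_le add_mono pair_le)

lemma nm_add: "x \<in> carrier \<Longrightarrow> y \<in> carrier \<Longrightarrow> nm (x + y) \<le> nm x + nm y"
  by (rule nm_least) (auto simp: pair_add intro!: norm_triangle_le add_mono pair_le)

lemma carrier_scale: "x \<in> carrier \<Longrightarrow> (\<lambda>r. c * x r) \<in> carrier"
  by (rule carrierI[where C = "cmod c * nm x"])
     (auto simp: pair_scale carrier_off norm_mult intro!: mult_left_mono pair_le)

lemma nm_scale_le: "x \<in> carrier \<Longrightarrow> nm (\<lambda>r. c * x r) \<le> cmod c * nm x"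
  by (rule nm_least) (auto simp: pair_scale norm_mult intro!: mult_left_mono pair_le)

lemma nm_scale: "x \<in> carrier \<Longrightarrow> nm (\<lambda>r. c * x r) = cmod c * nm x"
proof (cases "c = 0")
  case True
  then show ?thesis using nm_0 by (simp add: zero_fun_def)
next
  case False
  assume x: "x \<in> carrier"
  have "nm x \<le> cmod (1 / c) * nm (\<lambda>r. c * x r)"
    using nm_scale_le[OF carrier_scale[OF x, of c], of "1 / c"] False by simp
  then show ?thesis using nm_scale_le[OF x, of c] False
    by (simp add: norm_divide field_simps)
qed

lemma carrier_diff: "x \<in> carrier \<Longrightarrow> y \<in> carrier \<Longrightarrow> x - y \<in> carrier"
  by (rule carrierI[where C = "nm x + nm y"])
     (auto simp: pair_diff carrier_off intro!: order_trans[OF norm_triangle_ineq4] add_mono pair_le)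

lemma nm_diff_commute: "nm (x - y) = nm (y - x)"
  unfolding nm_def by (simp add: pair_diff norm_minus_commute)

lemma coord_bound: "\<exists>C>0. \<forall>x\<in>carrier. cmod (x (real j)) \<le> C * nm x"
proof -
  obtain c where c: "c \<noteq> 0" "single j c \<in> \<Psi>" using coord by blast
  have "cmod (x (real j)) \<le> (1 / cmod c) * nm x" if "x \<in> carrier" for x
    using pair_le[OF that c(2)] c(1) by (simp add: pair_single norm_mult field_simps)
  then show ?thesis using c by (intro exI[of _ "1 / cmod c"]) auto
qed

lemma nm_eq_0: "x \<in> carrier \<Longrightarrow> nm x = 0 \<Longrightarrow> x = 0"
proof
  fix r assume x: "x \<in> carrier" "nm x = 0"
  show "x r = 0 r"
  proof (cases "r \<in> \<nat>")
    case True
    then obtain j where "r = real j" by (auto elim: Nats_cases)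
    then show ?thesis using coord_bound[of j] x by auto
  qed (use x carrier_off in auto)
qed

lemma vector_space_fun: "vector_space (\<lambda>c (x :: real \<Rightarrow> complex) r. c * x r)"
  by unfold_locales (auto simp: algebra_simps)

lemma module_fun: "module (\<lambda>c (x :: real \<Rightarrow> complex) r. c * x r)"
  using vector_space_fun module_iff_vector_space by blast

lemma normed: "complex_normed_space space"
  unfolding complex_normed_space_def
  using vector_space_fun nm_nonneg nm_eq_0 nm_0 nm_add nm_scale carrier_0 carrier_add carrier_scale
  by (auto simp: module.subspace_def[OF module_fun])

lemma tendsto_coord:
  assumes "norm_tendsto space X l F" "\<And>n. X n \<in> carrier" "l \<in> carrier"
  shows "((\<lambda>n. X n (real j)) \<longlongrightarrow> l (real j)) F"
proof -
  obtain C where C: "\<And>x. x \<in> carrier \<Longrightarrow> cmod (x (real j)) \<le> C * nm x"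
    using coord_bound[of j] by blast
  have "((\<lambda>n. C * nm (X n - l)) \<longlongrightarrow> 0) F"
    using assms(1) tendsto_mult_right_zero by (auto simp: norm_tendsto_def)
  then have "((\<lambda>n. X n (real j) - l (real j)) \<longlongrightarrow> 0) F"
    by (rule Lim_null_comparison[rotated])
       (use C[OF carrier_diff[OF assms(2,3)]] in auto)
  then show ?thesis by (simp add: LIM_zero_iff)
qed

lemma banach: "complex_banach_space space"
  unfolding complex_banach_space_def
proof (intro conjI allI impI normed)
  fix X :: "nat \<Rightarrow> real \<Rightarrow> complex"
  assume "range X \<subseteq> vecs space \<and> norm_Cauchy space X"
  then have X: "\<And>n. X n \<in> carrier"
    and cau: "\<And>e. e > 0 \<Longrightarrow> \<exists>M. \<forall>m\<ge>M. \<forall>n\<ge>M. nm (X m - X n) < e"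
    by (auto simp: norm_Cauchy_def)
  have "\<exists>l. (\<lambda>n. X n (real j)) \<longlonglongrightarrow> l" for j
  proof -
    obtain C where C: "C > 0" "\<And>x. x \<in> carrier \<Longrightarrow> cmod (x (real j)) \<le> C * nm x"
      using coord_bound[of j] by blast
    have "Cauchy (\<lambda>n. X n (real j))"
    proof (rule CauchyI)
      fix e :: real assume "e > 0"
      then obtain M where M: "\<forall>m\<ge>M. \<forall>n\<ge>M. nm (X m - X n) < e / C"
        using cau[of "e / C"] C by auto
      have "cmod (X m (real j) - X n (real j)) < e" if "m \<ge> M" "n \<ge> M" for m n
      proof -
        have "cmod (X m (real j) - X n (real j)) \<le> C * nm (X m - X n)"
          using C(2)[OF carrier_diff[OF X X, of m n]] by simp
        also have "\<dots> < e" using M that C by (simp add: field_simps)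
        finally show ?thesis .
      qed
      then show "\<exists>M. \<forall>m\<ge>M. \<forall>n\<ge>M. cmod (X m (real j) - X n (real j)) < e" by blast
    qed
    then show ?thesis by (simp add: Cauchy_convergent_iff convergent_def)
  qed
  then obtain L where L: "\<And>j. (\<lambda>n. X n (real j)) \<longlonglongrightarrow> L j" by metis
  define l :: "real \<Rightarrow> complex" where "l r = (if r \<in> \<nat> then L (nat \<lfloor>r\<rfloor>) else 0)" for r
  have l: "(\<lambda>n. X n (real j)) \<longlonglongrightarrow> l (real j)" for j
    using L by (simp add: l_def)
  \<comment> \<open>Each functional involves finitely many coordinates, so coordinatewise
    convergence suffices; the supremum over functionals is taken only after this limit.\<close>
  have pl: "(\<lambda>n. pair \<psi> (X n - y)) \<longlonglongrightarrow> pair \<psi> (l - y)" for \<psi> y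
    unfolding pair_def by (auto intro!: tendsto_intros l)
  have bound: "cmod (pair \<psi> (l - X m)) \<le> e"
    if M: "\<forall>m\<ge>M. \<forall>n\<ge>M. nm (X m - X n) < e" and m: "m \<ge> M" and \<psi>: "\<psi> \<in> \<Psi>" for e m M \<psi>
  proof (rule tendsto_upperbound[OF tendsto_norm[OF pl]])
    show "\<forall>\<^sub>F n in sequentially. cmod (pair \<psi> (X n - X m)) \<le> e"
      using eventually_ge_at_top[of M]
    proof eventually_elim
      case (elim n)
      have "cmod (pair \<psi> (X n - X m)) \<le> nm (X n - X m)"
        by (intro pair_le carrier_diff X \<psi>)
      also have "\<dots> < e" using M elim m by blast
      finally show ?case by simp
    qed
  qed simp
  have lc: "l \<in> carrier"
  proof -
    obtain M where "\<forall>m\<ge>M. \<forall>n\<ge>M. nm (X m - X n) < 1" using cau[of 1] by auto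
    then have "l - X M \<in> carrier"
      using bound[of M 1 M]
      by (intro carrierI[where C = 1]) (auto simp: l_def carrier_off[OF X])
    from carrier_add[OF this X[of M]] show ?thesis by simp
  qed
  moreover have "norm_tendsto space X l sequentially"
    unfolding norm_tendsto_def
  proof (rule LIMSEQ_I)
    fix e :: real assume "e > 0"
    then obtain M where M: "\<forall>m\<ge>M. \<forall>n\<ge>M. nm (X m - X n) < e / 2" using cau[of "e / 2"] by auto
    have "nm (X m - l) \<le> e / 2" if "m \<ge> M" for m
      using nm_least[of "l - X m" "e / 2"] bound[OF M that] by (subst nm_diff_commute) auto
    then have "norm (nrm space (X m - l) - 0) < e" if "m \<ge> M" for m
      using that \<open>e > 0\<close> nm_nonneg[OF carrier_diff[OF X lc, of m]] by force
    then show "\<exists>M. \<forall>m\<ge>M. norm (nrm space (X m - l) - 0) < e" by blast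
  qed
  ultimately show "\<exists>l\<in>vecs space. norm_tendsto space X l sequentially" by auto
qed

section \<open>Truncation at block boundaries and orthogonality of head and tail\<close>

definition trunc :: "nat \<Rightarrow> (real \<Rightarrow> complex) \<Rightarrow> real \<Rightarrow> complex" where
  "trunc n x r = (if r < real (cut n) then x r else 0)"

lemma pair_trunc: "finite {j. \<psi> j \<noteq> 0} \<Longrightarrow>
    pair \<psi> (trunc n x) = pair (\<lambda>j. if j < cut n then \<psi> j else 0) x"
  by (subst (2) pair_eq[of "{j. \<psi> j \<noteq> 0}"]) (auto simp: pair_def trunc_def intro!: sum.cong)

lemma pair_tail: "finite {j. \<psi> j \<noteq> 0} \<Longrightarrow>
    pair \<psi> (x - trunc n x) = pair (\<lambda>j. if j < cut n then 0 else \<psi> j) x"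
  by (subst (2) pair_eq[of "{j. \<psi> j \<noteq> 0}"]) (auto simp: pair_def trunc_def intro!: sum.cong)

lemma pair_split:
  assumes "\<psi> \<in> \<Psi>"
  obtains a b \<psi>1 \<psi>2 where "0 \<le> a" "0 \<le> b" "a\<^sup>2 + b\<^sup>2 \<le> 1" "\<psi>1 \<in> \<Psi>" "\<psi>2 \<in> \<Psi>"
    "\<And>x. pair \<psi> (trunc n x) = complex_of_real a * pair \<psi>1 x"
    "\<And>x. pair \<psi> (x - trunc n x) = complex_of_real b * pair \<psi>2 x"
proof -
  obtain a b \<psi>1 \<psi>2 where ab: "0 \<le> a" "0 \<le> b" "a\<^sup>2 + b\<^sup>2 \<le> 1" "\<psi>1 \<in> \<Psi>" "\<psi>2 \<in> \<Psi>"
    "(\<lambda>j. if j < cut n then \<psi> j else 0) = (\<lambda>j. complex_of_real a * \<psi>1 j)"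
    "(\<lambda>j. if j < cut n then 0 else \<psi> j) = (\<lambda>j. complex_of_real b * \<psi>2 j)"
    using split[OF assms, of n] unfolding fun_eq_iff by blast
  show ?thesis
    by (rule that[of a b \<psi>1 \<psi>2])
       (use ab in \<open>simp_all add: pair_trunc[OF fin[OF assms]] pair_tail[OF fin[OF assms]] pair_cmult\<close>)
qed

lemma nm_trunc:
  assumes x: "x \<in> carrier"
  shows "trunc n x \<in> carrier" "nm (trunc n x) \<le> nm x" "nm (x - trunc n x) \<le> nm x"
proof -
  have *: "cmod (pair \<psi> (trunc n x)) \<le> nm x \<and> cmod (pair \<psi> (x - trunc n x)) \<le> nm x"
    if \<psi>: "\<psi> \<in> \<Psi>" for \<psi>
  proof -
    obtain a b \<psi>1 \<psi>2 where ab: "0 \<le> a" "0 \<le> b" "a\<^sup>2 + b\<^sup>2 \<le> 1" "\<psi>1 \<in> \<Psi>" "\<psi>2 \<in> \<Psi>"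
      "\<And>x. pair \<psi> (trunc n x) = complex_of_real a * pair \<psi>1 x"
      "\<And>x. pair \<psi> (x - trunc n x) = complex_of_real b * pair \<psi>2 x"
      using pair_split[OF \<psi>, of n] by blast
    have "a * cmod (pair \<psi>1 x) \<le> 1 * nm x" "b * cmod (pair \<psi>2 x) \<le> 1 * nm x"
      using le_one_of_sq[OF ab(1-3)] ab(1,2) pair_le[OF x ab(4)] pair_le[OF x ab(5)]
        mult_mono[of a 1 "cmod (pair \<psi>1 x)" "nm x"] mult_mono[of b 1 "cmod (pair \<psi>2 x)" "nm x"]
      by simp_all
    then show ?thesis using ab by (simp add: norm_mult)
  qed
  show "trunc n x \<in> carrier"
    using * by (intro carrierI[where C = "nm x"]) (auto simp: trunc_def carrier_off[OF x])
  show "nm (trunc n x) \<le> nm x" "nm (x - trunc n x) \<le> nm x"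
    using * by (auto intro!: nm_least)
qed

text \<open>By \<open>split\<close>, a functional tests \<open>x\<close> and \<open>y\<close>
  through two members of the set with coefficients \<open>a\<close> and \<open>b\<close>;
  Cauchy-Schwarz in the plane does the rest.\<close>

lemma nm_upper:
  assumes x: "x \<in> carrier" and y: "y \<in> carrier" and tx: "trunc n x = x" and ty: "trunc n y = 0"
  shows "nm (x + y) \<le> sqrt ((nm x)\<^sup>2 + (nm y)\<^sup>2)"
proof (rule nm_least)
  fix \<psi> assume \<psi>: "\<psi> \<in> \<Psi>"
  obtain a b \<psi>1 \<psi>2 where ab: "0 \<le> a" "0 \<le> b" "a\<^sup>2 + b\<^sup>2 \<le> 1" "\<psi>1 \<in> \<Psi>" "\<psi>2 \<in> \<Psi>"
    "\<And>x. pair \<psi> (trunc n x) = complex_of_real a * pair \<psi>1 x"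
    "\<And>x. pair \<psi> (x - trunc n x) = complex_of_real b * pair \<psi>2 x"
    using pair_split[OF \<psi>, of n] by blast
  have "pair \<psi> (x + y) = of_real a * pair \<psi>1 x + of_real b * pair \<psi>2 y"
    using ab(6)[of x] ab(7)[of y] tx ty by (simp add: pair_add)
  then have "cmod (pair \<psi> (x + y)) \<le> a * cmod (pair \<psi>1 x) + b * cmod (pair \<psi>2 y)"
    using norm_triangle_ineq[of "of_real a * pair \<psi>1 x" "of_real b * pair \<psi>2 y"] ab
    by (simp add: norm_mult)
  also have "\<dots> \<le> a * nm x + b * nm y"
    using ab pair_le[OF x] pair_le[OF y] by (intro add_mono mult_left_mono) auto
  also have "\<dots> \<le> sqrt ((nm x)\<^sup>2 + (nm y)\<^sup>2)"
  proof (rule real_le_rsqrt)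
    have "(a * nm x + b * nm y)\<^sup>2 \<le> (a\<^sup>2 + b\<^sup>2) * ((nm x)\<^sup>2 + (nm y)\<^sup>2)"
      using zero_le_power2[of "a * nm y - b * nm x"] by (simp add: power2_eq_square algebra_simps)
    also have "\<dots> \<le> 1 * ((nm x)\<^sup>2 + (nm y)\<^sup>2)"
      using ab by (intro mult_right_mono) auto
    finally show "(a * nm x + b * nm y)\<^sup>2 \<le> (nm x)\<^sup>2 + (nm y)\<^sup>2" by simp
  qed
  finally show "cmod (pair \<psi> (x + y)) \<le> sqrt ((nm x)\<^sup>2 + (nm y)\<^sup>2)" .
qed

text \<open>\<open>comb\<close> merges the two functionals. With coefficients proportional to the
  conjugates of the two values, the merged functional takes at \<open>x\<close> the Euclidean length
  of the pair of values.\<close>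

lemma pair_lower:
  assumes x: "x \<in> carrier" and \<psi>: "\<psi>1 \<in> \<Psi>" "\<psi>2 \<in> \<Psi>"
  shows "(cmod (pair \<psi>1 (trunc n x)))\<^sup>2 + (cmod (pair \<psi>2 (x - trunc n x)))\<^sup>2 \<le> (nm x)\<^sup>2"
proof -
  define p q where "p = pair \<psi>1 (trunc n x)" and "q = pair \<psi>2 (x - trunc n x)"
  define s where "s = sqrt ((cmod p)\<^sup>2 + (cmod q)\<^sup>2)"
  have s2: "s\<^sup>2 = (cmod p)\<^sup>2 + (cmod q)\<^sup>2" by (simp add: s_def)
  show ?thesis
  proof (cases "s = 0")
    case True
    then show ?thesis using s2 by (simp add: p_def q_def)
  next
    case False
    define a b where "a = cnj p / of_real s" and "b = cnj q / of_real s"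
    let ?\<psi> = "\<lambda>j. if j < cut n then a * \<psi>1 j else b * \<psi>2 j"
    have "(cmod a)\<^sup>2 + (cmod b)\<^sup>2 = s\<^sup>2 / s\<^sup>2"
      unfolding s2[THEN arg_cong[where f = "\<lambda>t. t / s\<^sup>2"]]
      by (simp add: a_def b_def norm_divide power_divide add_divide_distrib)
    then have "(cmod a)\<^sup>2 + (cmod b)\<^sup>2 = 1" using False by simp
    then have \<psi>m: "?\<psi> \<in> \<Psi>" by (intro comb \<psi>) simp
    let ?S = "{j. \<psi>1 j \<noteq> 0} \<union> {j. \<psi>2 j \<noteq> 0}"
    have fS: "finite ?S" using fin \<psi> by blast
    have pp: "p = (\<Sum>j\<in>?S. \<psi>1 j * trunc n x (real j))"
      unfolding p_def by (rule pair_eq[OF fS]) auto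
    have qq: "q = (\<Sum>j\<in>?S. \<psi>2 j * (x - trunc n x) (real j))"
      unfolding q_def by (rule pair_eq[OF fS]) auto
    have "pair ?\<psi> x = (\<Sum>j\<in>?S. ?\<psi> j * x (real j))"
      by (rule pair_eq[OF fS]) auto
    also have "\<dots> = a * p + b * q"
      unfolding pp qq sum_distrib_left sum.distrib[symmetric]
      by (intro sum.cong) (auto simp: trunc_def)
    also have "\<dots> = (p * cnj p + q * cnj q) / of_real s"
      by (simp add: a_def b_def add_divide_distrib mult.commute)
    also have "\<dots> = of_real ((cmod p)\<^sup>2 + (cmod q)\<^sup>2) / of_real s"
      by (simp only: complex_norm_square of_real_add)
    also have "\<dots> = of_real s"
      unfolding s2[symmetric] using False by (simp add: power2_eq_square)
    finally have "\<bar>s\<bar> \<le> nm x" using pair_le[OF x \<psi>m] by simp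
    then show ?thesis using s2 by (metis p_def q_def abs_ge_zero power2_abs power_mono)
  qed
qed

text \<open>The two suprema are taken one after the other, the second functional being fixed during
  the first; the square roots bring each estimate into the form that \<open>nm_least\<close>
  accepts.\<close>

lemma nm_lower:
  assumes x: "x \<in> carrier"
  shows "(nm (trunc n x))\<^sup>2 + (nm (x - trunc n x))\<^sup>2 \<le> (nm x)\<^sup>2"
proof -
  note nn = nm_nonneg[OF nm_trunc(1)[OF x]] nm_nonneg[OF carrier_diff[OF x nm_trunc(1)[OF x]]]
  have "nm (trunc n x) \<le> sqrt ((nm x)\<^sup>2 - (cmod (pair \<psi>2 (x - trunc n x)))\<^sup>2)" if "\<psi>2 \<in> \<Psi>" for \<psi>2
    using pair_lower[OF x _ that, of _ n] by (intro nm_least real_le_rsqrt) (simp add: algebra_simps)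
  then have A: "(nm (trunc n x))\<^sup>2 + (cmod (pair \<psi>2 (x - trunc n x)))\<^sup>2 \<le> (nm x)\<^sup>2" if "\<psi>2 \<in> \<Psi>" for \<psi>2
    using that nn(1)[of n] by (smt (verit) power_mono real_sqrt_ge_0_iff real_sqrt_pow2 real_sqrt_less_iff)
  then have "nm (x - trunc n x) \<le> sqrt ((nm x)\<^sup>2 - (nm (trunc n x))\<^sup>2)"
    by (intro nm_least real_le_rsqrt) (simp add: algebra_simps)
  moreover have "(nm x)\<^sup>2 - (nm (trunc n x))\<^sup>2 \<ge> 0"
    using nm_trunc(2)[OF x] nn(1) by (simp add: power_mono)
  ultimately show ?thesis
    using power_mono[OF _ nn(2), of n "sqrt ((nm x)\<^sup>2 - (nm (trunc n x))\<^sup>2)" 2] by simp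
qed

text \<open>A functional that almost attains the norm has finite support, so truncations beyond that
  support have almost full norm, and \<open>nm_lower\<close> leaves no room for the tail. Finitely
  supported vectors are thus dense, although \<open>carrier\<close> only asks for a finite
  supremum.\<close>

lemma trunc_tendsto:
  assumes x: "x \<in> carrier"
  shows "(\<lambda>n. nm (x - trunc n x)) \<longlonglongrightarrow> 0"
proof (rule LIMSEQ_I)
  fix e :: real assume e: "e > 0"
  show "\<exists>M. \<forall>n\<ge>M. norm (nm (x - trunc n x) - 0) < e"
  proof (cases "nm x = 0")
    case True
    then show ?thesis using e nm_trunc(3)[OF x] nm_nonneg[OF carrier_diff[OF x nm_trunc(1)[OF x]]]
      by (auto simp: order_le_less_trans[OF _ e])
  next
    case False
    then have pos: "nm x > 0" using nm_nonneg[OF x] by simp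
    \<comment> \<open>Chosen so that \<open>d * (2 * nm x)\<close>, the bound for the difference of
      squares below, is half of \<open>e\<^sup>2\<close>.\<close>
    define d where "d = e\<^sup>2 / (4 * nm x)"
    have d: "d > 0" using e pos by (simp add: d_def)
    have "\<exists>\<psi>\<in>\<Psi>. cmod (pair \<psi> x) > nm x - d"
      using nm_least[of x "nm x - d"] d by force
    then obtain \<psi> where \<psi>: "\<psi> \<in> \<Psi>" "cmod (pair \<psi> x) > nm x - d" by blast
    define K where "K = Max (insert 0 {j. \<psi> j \<noteq> 0})"
    have K: "\<psi> j \<noteq> 0 \<Longrightarrow> j \<le> K" for j
      unfolding K_def using fin[OF \<psi>(1)] by (intro Max_ge) auto
    obtain M where M: "K < cut M" using cut_unbounded by blast
    have "nm (x - trunc n x) < e" if n: "n \<ge> M" for n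
    proof -
      have "K < cut n" using M monoD[OF mono_cut n] by simp
      then have "(\<lambda>j. if j < cut n then \<psi> j else 0) = \<psi>" using K by fastforce
      then have "pair \<psi> (trunc n x) = pair \<psi> x" by (simp add: pair_trunc[OF fin[OF \<psi>(1)]])
      then have 1: "nm (trunc n x) > nm x - d"
        using pair_le[OF nm_trunc(1)[OF x] \<psi>(1), of n] \<psi>(2) by simp
      have 2: "nm (trunc n x) \<le> nm x" "0 \<le> nm (trunc n x)"
        using nm_trunc[OF x] nm_nonneg by auto
      have "(nm (x - trunc n x))\<^sup>2 \<le> (nm x - nm (trunc n x)) * (nm x + nm (trunc n x))"
        using nm_lower[OF x, of n] by (simp add: power2_eq_square algebra_simps)
      also have "\<dots> \<le> d * (2 * nm x)"
        using 1 2 d by (intro mult_mono) auto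
      also have "\<dots> < e\<^sup>2" using e pos by (simp add: d_def field_simps)
      finally show ?thesis using e by (simp add: power2_less_imp_less)
    qed
    then show ?thesis using nm_nonneg[OF carrier_diff[OF x nm_trunc(1)[OF x]]] by auto
  qed
qed

end

section \<open>Reflexivity\<close>

context norming begin

lemma unit_carrier: "unit j \<in> carrier"
proof -
  obtain C where "\<forall>\<psi>\<in>\<Psi>. cmod (\<psi> j) \<le> C" using bdd by blast
  then show ?thesis
    by (intro carrierI[where C = C]) (auto simp: unit_def pair_unit[OF fin])
qed

lemma carrier_sum: "finite S \<Longrightarrow> (\<And>i. i \<in> S \<Longrightarrow> X i \<in> carrier) \<Longrightarrow> (\<Sum>i\<in>S. X i) \<in> carrier"
  by (induction S rule: finite_induct) (auto intro: carrier_0 carrier_add)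

lemma linear_on_0:
  assumes "linear_on carrier (\<lambda>c x r. c * x r) (*) f"
  shows "f 0 = 0"
proof -
  have "f (0 + 0) = f 0 + f 0" using assms carrier_0 unfolding linear_on_def by blast
  then show ?thesis by simp
qed

lemma linear_on_diff:
  assumes "linear_on carrier (\<lambda>c x r. c * x r) (*) f" "x \<in> carrier" "y \<in> carrier"
  shows "f (x - y) = f x - f y"
proof -
  have "f ((x - y) + y) = f (x - y) + f y"
    using assms carrier_diff[OF assms(2,3)] unfolding linear_on_def by blast
  then show ?thesis by simp
qed

lemma linear_on_sum:
  assumes lin: "linear_on carrier (\<lambda>c x r. c * x r) (*) f"
    and "finite S" "\<And>i. i \<in> S \<Longrightarrow> X i \<in> carrier"
  shows "f (\<Sum>i\<in>S. X i) = (\<Sum>i\<in>S. f (X i))"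
  using assms(2,3)
proof (induction S rule: finite_induct)
  case empty
  then show ?case using linear_on_0[OF lin] by (simp add: zero_fun_def)
next
  case (insert i S)
  have "X i \<in> carrier" "sum X S \<in> carrier" using insert carrier_sum[of S X] by auto
  then have "f (X i + sum X S) = f (X i) + f (sum X S)" using lin unfolding linear_on_def by blast
  then show ?case using insert by (simp del: plus_fun_apply)
qed

lemma fun_sum_apply: "(\<Sum>i\<in>S. X i) r = (\<Sum>i\<in>S. X i r)" for X :: "'b \<Rightarrow> 'c \<Rightarrow> complex"
  by (induction S rule: infinite_finite_induct) auto

lemma trunc_eq_sum:
  assumes x: "x \<in> carrier"
  shows "trunc n x = (\<Sum>j<cut n. (\<lambda>r. x (real j) * unit j r))"
proof
  fix r
  show "trunc n x r = (\<Sum>j<cut n. (\<lambda>r. x (real j) * unit j r)) r"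
  proof (cases "r \<in> \<nat>")
    case True
    then obtain i where i: "r = real i" by (auto elim: Nats_cases)
    have "(\<Sum>j<cut n. x (real j) * unit j r) = (\<Sum>j<cut n. if j = i then x (real j) else 0)"
      by (intro sum.cong) (auto simp: i unit_def)
    then show ?thesis by (simp add: trunc_def i fun_sum_apply)
  next
    case False
    then have "unit j r = 0" for j by (auto simp: unit_def)
    then show ?thesis using carrier_off[OF x False] by (simp add: trunc_def fun_sum_apply)
  qed
qed

lemma dual_simps:
  "f \<in> vecs (dual space) \<longleftrightarrow> linear_on carrier (\<lambda>c x r. c * x r) (*) f \<and>
     (\<exists>C. \<forall>x\<in>carrier. cmod (f x) \<le> C * nm x) \<and> (\<forall>x. x \<notin> carrier \<longrightarrow> f x = 0)"
  by (simp add: dual_def)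

lemma dual_le: "f \<in> vecs (dual space) \<Longrightarrow> x \<in> carrier \<Longrightarrow> cmod (f x) \<le> nrm (dual space) f * nm x"
  using dual_norm_bound[OF normed] by simp

lemma dual_least: "(\<And>x. x \<in> carrier \<Longrightarrow> nm x \<le> 1 \<Longrightarrow> cmod (f x) \<le> C) \<Longrightarrow> nrm (dual space) f \<le> C"
  using dual_norm_least[OF normed] by simp

lemma dual_nonneg: "f \<in> vecs (dual space) \<Longrightarrow> 0 \<le> nrm (dual space) f"
proof -
  assume f: "f \<in> vecs (dual space)"
  have "unit 0 \<noteq> 0" by (auto simp: unit_def fun_eq_iff)
  then have "nm (unit 0) > 0"
    using nm_eq_0[OF unit_carrier] nm_nonneg[OF unit_carrier, of 0] by fastforce
  moreover have "0 \<le> nrm (dual space) f * nm (unit 0)"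
    using dual_le[OF f unit_carrier[of 0]] norm_ge_zero order_trans by blast
  ultimately show ?thesis by (simp add: zero_le_mult_iff)
qed

lemma trunc_zero_tail: "trunc n (y - trunc n y) = 0"
  by (auto simp: trunc_def)

text \<open>
  Near a maximiser \<open>u\<close> of \<open>f\<close>, which may be taken finitely supported, orthogonality of disjointly
  supported blocks turns \<open>\<bar>f (u + t y)\<bar> \<le> \<parallel>f\<parallel> \<surd>(1 + t\<^sup>2)\<close> into smallness of \<open>f y\<close>.
\<close>

lemma dual_tail_small:
  assumes f: "f \<in> vecs (dual space)" and e: "e > 0"
  shows "\<exists>n0. \<forall>n\<ge>n0. \<forall>y\<in>carrier. trunc n y = 0 \<longrightarrow> nm y \<le> 1 \<longrightarrow> cmod (f y) \<le> e"
proof -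
  define N where "N = nrm (dual space) f"
  have N0: "N \<ge> 0" using dual_nonneg[OF f] by (simp add: N_def)
  \<comment> \<open>With this \<open>t\<close> and the \<open>h\<close> below, both terms of the
    later bound \<open>h + N * t\<^sup>2 / 2\<close> are at most \<open>e * t / 2\<close>; the
    \<open>N + 1\<close> keeps the quotient defined when \<open>N = 0\<close>.\<close>
  define t where "t = e / (N + 1)"
  have t: "t > 0" using e N0 by (simp add: t_def)
  define h where "h = e * t / 2"
  have h: "h > 0" using e t by (simp add: h_def)
  have lin: "linear_on carrier (\<lambda>c x r. c * x r) (*) f" using f by (simp add: dual_simps)
  have "\<exists>u\<in>carrier. nm u \<le> 1 \<and> cmod (f u) > N - h / 2"
    using dual_least[of f "N - h / 2"] h unfolding N_def by force
  then obtain u where u: "u \<in> carrier" "nm u \<le> 1" "cmod (f u) > N - h / 2" by blast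
  have "(\<lambda>n. N * nm (u - trunc n u)) \<longlonglongrightarrow> N * 0"
    by (intro tendsto_mult_left trunc_tendsto u)
  then have "\<forall>\<^sub>F n in sequentially. N * nm (u - trunc n u) < h / 2"
    using h by (intro order_tendstoD(2)) auto
  then obtain n0 where n0: "N * nm (u - trunc n0 u) < h / 2"
    by (auto simp: eventually_sequentially)
  define v where "v = trunc n0 u"
  have v: "v \<in> carrier" "nm v \<le> 1" using nm_trunc[OF u(1), of n0] u(2) by (auto simp: v_def)
  have "cmod (f u - f v) \<le> N * nm (u - v)"
    using dual_le[OF f carrier_diff[OF u(1) v(1)]] linear_on_diff[OF lin u(1) v(1)]
    by (simp add: N_def)
  then have fv: "cmod (f v) > N - h"
    using n0 u(3) norm_triangle_sub[of "f u" "f v"] by (simp add: v_def)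
  have "cmod (f y) \<le> e" if n: "n \<ge> n0" and y: "y \<in> carrier" "trunc n y = 0" "nm y \<le> 1" for n y
  proof -
    \<comment> \<open>The phases turn both values into nonnegative reals, so that the modulus of the
      sum is the sum of the moduli.\<close>
    obtain p where p: "cmod p = 1" "p * f y = of_real (cmod (f y))" by (rule unimodular_phase)
    obtain q where q: "cmod q = 1" "q * f v = of_real (cmod (f v))" by (rule unimodular_phase)
    let ?v = "\<lambda>r. q * v r" and ?y = "\<lambda>r. (of_real t * p) * y r"
    have c: "?v \<in> carrier" "?y \<in> carrier" using v y carrier_scale by auto
    have cut: "cut n0 \<le> cut n" using mono_cut n by (auto dest: monoD)
    have tr: "trunc n ?v = ?v" using cut by (auto simp: trunc_def v_def fun_eq_iff)
    have ty: "trunc n ?y = 0"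
      using y(2) by (auto simp: trunc_def fun_eq_iff split: if_splits)
    have "nm (?v + ?y) \<le> sqrt ((nm ?v)\<^sup>2 + (nm ?y)\<^sup>2)"
      by (rule nm_upper[OF c tr ty])
    also have "\<dots> = sqrt ((nm v)\<^sup>2 + t\<^sup>2 * (nm y)\<^sup>2)"
      using t by (simp add: nm_scale v y p q norm_mult power_mult_distrib)
    also have "\<dots> \<le> sqrt (1 + t\<^sup>2 * 1)"
    proof -
      have "(nm v)\<^sup>2 \<le> 1" "(nm y)\<^sup>2 \<le> 1"
        using v y nm_nonneg by (auto intro: power_le_one)
      then show ?thesis by (intro real_sqrt_le_mono add_mono mult_left_mono) auto
    qed
    also have "\<dots> \<le> sqrt ((1 + t\<^sup>2 / 2)\<^sup>2)"
      by (intro real_sqrt_le_mono) (simp add: power2_sum)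
    also have "\<dots> = 1 + t\<^sup>2 / 2" by (simp add: add_nonneg_nonneg)
    finally have nb: "nm (?v + ?y) \<le> 1 + t\<^sup>2 / 2" .
    have "f (?v + ?y) = q * f v + of_real t * (p * f y)"
      using lin c v y by (simp add: linear_on_def del: plus_fun_apply)
    also have "\<dots> = of_real (cmod (f v) + t * cmod (f y))" using p q by simp
    finally have "cmod (f (?v + ?y)) = cmod (f v) + t * cmod (f y)"
      using t by (simp only: norm_of_real) simp
    moreover have "cmod (f (?v + ?y)) \<le> N * nm (?v + ?y)"
      using dual_le[OF f carrier_add[OF c]] by (simp add: N_def)
    moreover have "N * nm (?v + ?y) \<le> N * (1 + t\<^sup>2 / 2)"
      using nb N0 by (intro mult_left_mono)
    ultimately have "t * cmod (f y) \<le> h + N * t\<^sup>2 / 2"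
      using fv by (simp add: algebra_simps)
    also have "N * t\<^sup>2 / 2 \<le> e * t / 2"
    proof -
      have "N * t \<le> (N + 1) * t" using t by (intro mult_right_mono) auto
      also have "\<dots> = e" using N0 by (simp add: t_def)
      finally have "N * t * t \<le> e * t" using t by (intro mult_right_mono) auto
      then show ?thesis by (simp add: power2_eq_square algebra_simps)
    qed
    finally have "t * cmod (f y) \<le> t * e" by (simp add: h_def algebra_simps)
    then show ?thesis using t by simp
  qed
  then show ?thesis by blast
qed

section \<open>Coordinate functionals, their finite combinations, and the bidual\<close>

definition coordf :: "nat \<Rightarrow> (real \<Rightarrow> complex) \<Rightarrow> complex" where
  "coordf j x = (if x \<in> carrier then x (real j) else 0)"

lemma coordf_dual: "coordf j \<in> vecs (dual space)"
  using coord_bound[of j] carrier_add carrier_scale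
  by (auto simp: dual_simps coordf_def linear_on_def)

lemma dual_comb:
  assumes "finite S" "\<And>j. j \<in> S \<Longrightarrow> g j \<in> vecs (dual space)"
  shows "(\<lambda>x. \<Sum>j\<in>S. c j * g j x) \<in> vecs (dual space)"
proof -
  have lin: "linear_on carrier (\<lambda>c x r. c * x r) (*) (g j)" if "j \<in> S" for j
    using assms(2)[OF that] by (simp add: dual_simps)
  have "\<forall>x\<in>carrier. cmod (\<Sum>j\<in>S. c j * g j x) \<le> (\<Sum>j\<in>S. cmod (c j) * nrm (dual space) (g j)) * nm x"
    unfolding sum_distrib_right
    by (intro ballI order_trans[OF norm_sum] sum_mono)
       (use dual_le[OF assms(2)] in \<open>auto simp: norm_mult mult.assoc intro!: mult_left_mono\<close>)
  moreover have "\<forall>j\<in>S. \<forall>x. x \<notin> carrier \<longrightarrow> g j x = 0"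
    using assms(2) by (simp add: dual_simps)
  moreover have "linear_on carrier (\<lambda>c x r. c * x r) (*) (\<lambda>x. \<Sum>j\<in>S. c j * g j x)"
    using lin by (auto simp: linear_on_def sum.distrib sum_distrib_left algebra_simps)
  ultimately show ?thesis unfolding dual_simps by auto
qed

lemma bidual_comb:
  assumes F: "linear_on (vecs (dual space)) (scl (dual space)) (*) F"
    and "finite S" "\<And>j. j \<in> S \<Longrightarrow> g j \<in> vecs (dual space)"
  shows "F (\<lambda>x. \<Sum>j\<in>S. c j * g j x) = (\<Sum>j\<in>S. c j * F (g j))"
  using assms(2,3)
proof (induction S rule: finite_induct)
  case empty
  have z: "(\<lambda>x. 0) \<in> vecs (dual space)" using dual_comb[of "{}"] by simp
  have "F (scl (dual space) 0 (\<lambda>x. 0)) = 0 * F (\<lambda>x. 0)" using F z unfolding linear_on_def by blast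
  then show ?case by (simp add: dual_def)
next
  case (insert i S)
  have 1: "(\<lambda>x. \<Sum>j\<in>S. c j * g j x) \<in> vecs (dual space)" using insert by (intro dual_comb) auto
  have 2: "scl (dual space) (c i) (g i) \<in> vecs (dual space)"
    using dual_comb[of "{i}" g c] insert by (simp add: dual_def)
  have "(\<lambda>x. \<Sum>j\<in>insert i S. c j * g j x) = scl (dual space) (c i) (g i) + (\<lambda>x. \<Sum>j\<in>S. c j * g j x)"
    using insert by (auto simp: dual_def)
  then show ?case using F 1 2 insert unfolding linear_on_def by simp
qed

text \<open>For surjectivity, \<open>F\<close> is read off on the coordinate functionals. The
  resulting \<open>x\<close> lies in \<open>carrier\<close> because each norming functional acts on
  it as \<open>F\<close> acts on a dual vector of norm at most 1. \<open>F f = f x\<close> is clear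
  for finite combinations of coordinates, and \<open>dual_tail_small\<close> shows that these
  approximate every \<open>f\<close> in the dual norm.\<close>

lemma reflexive_space: "reflexive space"
  unfolding reflexive_def
proof (intro equalityI subsetI)
  fix F assume "F \<in> canonical_embedding space ` vecs space"
  then obtain x where x: "x \<in> carrier" and F: "F = canonical_embedding space x" by auto
  have "cmod (F f) \<le> nm x * nrm (dual space) f" if "f \<in> vecs (dual space)" for f
    using dual_le[OF that x] that by (simp add: F canonical_embedding_def mult.commute)
  moreover have "linear_on (vecs (dual space)) (scl (dual space)) (*) F"
  proof -
    have "f + g \<in> vecs (dual space)" if "f \<in> vecs (dual space)" "g \<in> vecs (dual space)" for f g
      using dual_comb[of "{True, False}" "\<lambda>b. if b then f else g" "\<lambda>_. 1"] that
      by (simp add: plus_fun_def)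
    moreover have "scl (dual space) c f \<in> vecs (dual space)" if "f \<in> vecs (dual space)" for c f
      using dual_comb[of "{True}" "\<lambda>b. f" "\<lambda>_. c"] that by (simp add: dual_def)
    ultimately show ?thesis
      by (auto simp: linear_on_def F canonical_embedding_def) (auto simp: dual_def)
  qed
  ultimately show "F \<in> vecs (dual (dual space))"
    by (subst dual_def) (auto simp: F canonical_embedding_def)
next
  fix F assume F: "F \<in> vecs (dual (dual space))"
  have lin: "linear_on (vecs (dual space)) (scl (dual space)) (*) F"
    and off: "\<And>f. f \<notin> vecs (dual space) \<Longrightarrow> F f = 0"
    and "\<exists>C. \<forall>f\<in>vecs (dual space). cmod (F f) \<le> C * nrm (dual space) f"
    using F by (subst (asm) dual_def; simp)+
  then obtain C0 where C0: "\<And>f. f \<in> vecs (dual space) \<Longrightarrow> cmod (F f) \<le> C0 * nrm (dual space) f"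
    by blast
  define C where "C = \<bar>C0\<bar>"
  have C: "cmod (F f) \<le> C * nrm (dual space) f" if "f \<in> vecs (dual space)" for f
    using C0[OF that] dual_nonneg[OF that] mult_right_mono[of C0 C "nrm (dual space) f"]
    unfolding C_def by linarith
  have Cpos: "C \<ge> 0" by (simp add: C_def)
  define x :: "real \<Rightarrow> complex" where "x r = (if r \<in> \<nat> then F (coordf (nat \<lfloor>r\<rfloor>)) else 0)" for r
  have xj: "x (real j) = F (coordf j)" for j by (simp add: x_def)
  have xc: "x \<in> carrier"
  proof (rule carrierI[where C = C])
    fix \<psi> assume \<psi>: "\<psi> \<in> \<Psi>"
    let ?S = "{j. \<psi> j \<noteq> 0}"
    let ?g = "\<lambda>y. \<Sum>j\<in>?S. \<psi> j * coordf j y"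
    have g: "?g \<in> vecs (dual space)" using fin[OF \<psi>] coordf_dual by (intro dual_comb)
    have "pair \<psi> x = F ?g"
      unfolding pair_def xj by (intro bidual_comb[OF lin fin[OF \<psi>], symmetric] coordf_dual)
    moreover have "nrm (dual space) ?g \<le> 1"
    proof (rule dual_least)
      fix y assume y: "y \<in> carrier" "nm y \<le> 1"
      have "?g y = pair \<psi> y" using y by (simp add: coordf_def pair_def)
      then show "cmod (?g y) \<le> 1" using pair_le[OF y(1) \<psi>] y(2) by simp
    qed
    then have "C * nrm (dual space) ?g \<le> C * 1" by (intro mult_left_mono Cpos)
    ultimately show "cmod (pair \<psi> x) \<le> C" using C[OF g] by simp
  qed (simp add: x_def)
  have "F f = f x" if f: "f \<in> vecs (dual space)" for f
  proof -
    have flin: "linear_on carrier (\<lambda>c x r. c * x r) (*) f" using f by (simp add: dual_simps)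
    define fn where "fn n = (\<lambda>y. \<Sum>j<cut n. f (unit j) * coordf j y)" for n
    have fn_dual: "fn n \<in> vecs (dual space)" for n
      unfolding fn_def by (intro dual_comb coordf_dual) auto
    have fn: "fn n y = f (trunc n y)" if y: "y \<in> carrier" for n y
    proof -
      have "f (trunc n y) = (\<Sum>j<cut n. f (\<lambda>r. y (real j) * unit j r))"
        unfolding trunc_eq_sum[OF y]
        by (rule linear_on_sum[OF flin]) (auto intro: carrier_scale unit_carrier)
      also have "\<dots> = (\<Sum>j<cut n. f (unit j) * y (real j))"
        by (intro sum.cong refl)
           (use flin unit_carrier in \<open>simp add: linear_on_def mult.commute[of "f _"]\<close>)
      finally show ?thesis using y by (simp add: fn_def coordf_def)
    qed
    have "F (fn n) = fn n x" for n
      unfolding fn_def by (subst bidual_comb[OF lin]) (auto simp: coordf_dual xj[symmetric] coordf_def xc)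
    then have Ffn: "F (fn n) = f (trunc n x)" for n using fn[OF xc] by simp
    have "(\<lambda>n. F f - F (fn n)) \<longlonglongrightarrow> 0"
    proof (rule LIMSEQ_I)
      fix e :: real assume e: "e > 0"
      define d where "d = e / (2 * (C + 1))"
      have d: "d > 0" using e Cpos by (simp add: d_def)
      obtain n0 where n0: "\<And>n y. n \<ge> n0 \<Longrightarrow> y \<in> carrier \<Longrightarrow> trunc n y = 0 \<Longrightarrow> nm y \<le> 1 \<Longrightarrow> cmod (f y) \<le> d"
        using dual_tail_small[OF f d] by blast
      have "cmod (F f - F (fn n)) < e" if n: "n \<ge> n0" for n
      proof -
        \<comment> \<open>The difference of \<open>f\<close> and \<open>fn n\<close>, indexed by
          Booleans so that the lemmas on finite combinations apply to it.\<close>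
        let ?g = "\<lambda>y. \<Sum>b\<in>{True, False}. (if b then 1 else -1) * (if b then f else fn n) y"
        have g: "?g \<in> vecs (dual space)" using f fn_dual by (intro dual_comb) auto
        have "F ?g = (\<Sum>b\<in>{True, False}. (if b then 1 else -1) * F (if b then f else fn n))"
          using f fn_dual by (intro bidual_comb[OF lin]) auto
        then have Fg: "F ?g = F f - F (fn n)" by simp
        have "nrm (dual space) ?g \<le> d"
        proof (rule dual_least)
          fix y assume y: "y \<in> carrier" "nm y \<le> 1"
          have "?g y = f (y - trunc n y)"
            using linear_on_diff[OF flin y(1) nm_trunc(1)[OF y(1)]] fn[OF y(1)] by simp
          then show "cmod (?g y) \<le> d"
            using n0[OF n carrier_diff[OF y(1) nm_trunc(1)[OF y(1)]] trunc_zero_tail]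
              nm_trunc(3)[OF y(1), of n] y(2) by simp
        qed
        then have "C * nrm (dual space) ?g \<le> C * d" by (intro mult_left_mono Cpos)
        then have "cmod (F f - F (fn n)) \<le> C * d" using C[OF g] Fg by simp
        also have "\<dots> \<le> (C + 1) * d" using d by (intro mult_right_mono) auto
        also have "\<dots> = e / 2" using Cpos by (simp add: d_def field_simps)
        also have "\<dots> < e" using e by simp
        finally show ?thesis .
      qed
      then show "\<exists>M. \<forall>n\<ge>M. norm (F f - F (fn n) - 0) < e" by auto
    qed
    moreover have "(\<lambda>n. f x - F (fn n)) \<longlonglongrightarrow> 0"
    proof (rule Lim_null_comparison)
      show "(\<lambda>n. nrm (dual space) f * nm (x - trunc n x)) \<longlonglongrightarrow> 0"
        using trunc_tendsto[OF xc] by (rule tendsto_mult_right_zero)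
      show "\<forall>\<^sub>F n in sequentially. norm (f x - F (fn n)) \<le> nrm (dual space) f * nm (x - trunc n x)"
        using dual_le[OF f carrier_diff[OF xc nm_trunc(1)[OF xc]]]
        by (simp add: Ffn linear_on_diff[OF flin xc nm_trunc(1)[OF xc], symmetric])
    qed
    ultimately have "(\<lambda>n. (F f - F (fn n)) - (f x - F (fn n))) \<longlonglongrightarrow> 0 - 0" by (rule tendsto_diff)
    then show ?thesis by (simp add: LIMSEQ_const_iff)
  qed
  then have "F = canonical_embedding space x"
    using off by (auto simp: canonical_embedding_def)
  then show "F \<in> canonical_embedding space ` vecs space" using xc by simp
qed

end

section \<open>The diagonal operator and its semigroup\<close>

text \<open>A generator controls only right difference quotients, hence the one-sided hypothesis.
  For slack \<open>e\<close>, the times up to which \<open>f\<close> stays within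
  \<open>e * s\<close> of \<open>f 0\<close> form an interval; continuity includes its supremum, and
  the right derivative there pushes further unless the supremum is \<open>b\<close>.\<close>

lemma right_derivative_zero_constant:
  fixes f :: "real \<Rightarrow> 'a::real_normed_vector"
  assumes b: "0 \<le> b" and cont: "continuous_on {0..b} f"
    and deriv: "\<And>t e. 0 \<le> t \<Longrightarrow> t < b \<Longrightarrow> 0 < e \<Longrightarrow>
      \<exists>d>0. \<forall>h. 0 < h \<longrightarrow> h < d \<longrightarrow> norm (f (t + h) - f t) \<le> e * h"
  shows "f b = f 0"
proof -
  have main: "norm (f b - f 0) \<le> e * b" if e: "e > 0" for e
  proof -
    define S where "S = {t\<in>{0..b}. \<forall>s\<in>{0..t}. norm (f s - f 0) \<le> e * s}"
    define c where "c = Sup S"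
    have S0: "0 \<in> S" using b by (simp add: S_def)
    have bd: "bdd_above S" by (rule bdd_aboveI[of _ b]) (simp add: S_def)
    have "c \<le> b" unfolding c_def
    proof (rule cSup_least)
      show "S \<noteq> {}" using S0 by blast
    qed (simp add: S_def)
    then have c: "0 \<le> c" "c \<le> b" using cSup_upper[OF S0 bd] by (simp_all add: c_def)
    have below: "norm (f s - f 0) \<le> e * s" if s: "0 \<le> s" "s < c" for s
    proof -
      obtain t where "t \<in> S" "s < t" using s less_cSup_iff[of S s] S0 bd by (auto simp: c_def)
      then show ?thesis using s by (simp add: S_def)
    qed
    have at_c: "norm (f c - f 0) \<le> e * c"
    proof (cases "c = 0")
      case False
      have "continuous_on {0..c} f" using c by (intro continuous_on_subset[OF cont]) auto
      then have "(f \<longlongrightarrow> f c) (at_left c)"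
        using c False by (simp add: continuous_on_Icc_at_leftD)
      then have L: "((\<lambda>s. e * s - norm (f s - f 0)) \<longlongrightarrow> e * c - norm (f c - f 0)) (at_left c)"
        by (intro tendsto_intros)
      have "\<forall>\<^sub>F s in at_left c. 0 < s" using c False by (intro eventually_at_leftI[of 0]) auto
      moreover have "\<forall>\<^sub>F s in at_left c. s < c" by (simp add: eventually_at_filter)
      ultimately have "\<forall>\<^sub>F s in at_left c. 0 \<le> e * s - norm (f s - f 0)"
        by eventually_elim (use below in auto)
      from tendsto_lowerbound[OF L this] show ?thesis by simp
    qed simp
    have "c = b"
    proof (rule ccontr)
      assume "c \<noteq> b"
      then have cb: "c < b" using c by simp
      obtain d where d: "d > 0" "\<And>h. 0 < h \<Longrightarrow> h < d \<Longrightarrow> norm (f (c + h) - f c) \<le> e * h"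
        using deriv[OF c(1) cb e] by blast
      define t where "t = min b (c + d / 2)"
      have t: "c < t" "t \<le> b" "t < c + d" using d cb by (auto simp: t_def)
      have "norm (f s - f 0) \<le> e * s" if s: "0 \<le> s" "s \<le> t" for s
      proof (cases "s < c \<or> s = c")
        case True
        then show ?thesis using below at_c s by auto
      next
        case False
        then have "norm (f s - f c) \<le> e * (s - c)" using d(2)[of "s - c"] s t by auto
        then show ?thesis
          using at_c norm_triangle_ineq[of "f s - f c" "f c - f 0"] by (simp add: algebra_simps)
      qed
      then have "t \<in> S" using t c by (simp add: S_def)
      then have "t \<le> c" using bd by (auto simp: c_def intro: cSup_upper)
      then show False using t by simp
    qed
    then show ?thesis using at_c by simp
  qed
  have "norm (f b - f 0) \<le> 0"
  proof (cases "b = 0")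
    case False
    show ?thesis
    proof (rule field_le_epsilon)
      fix e :: real assume "e > 0"
      then show "norm (f b - f 0) \<le> 0 + e" using main[of "e / b"] b False by simp
    qed
  qed simp
  then show ?thesis by simp
qed

text \<open>The resolvent bound in dual form: the transposed resolvent, scaled by
  \<open>\<bar>Re z\<bar> / K\<close>, maps the norming set into itself.\<close>

locale norming_resolvent = norming +
  fixes K :: real
  assumes K: "K > 0"
    and resolvent_mult: "\<psi> \<in> \<Psi> \<Longrightarrow> Re z \<noteq> 0 \<Longrightarrow>
       (\<lambda>j. complex_of_real (\<bar>Re z\<bar> / K) * (\<psi> j / (z - \<i> * of_nat j))) \<in> \<Psi>"
begin

section \<open>The diagonal operator: resolvent, closedness, density of the domain\<close>

definition opA :: "(real \<Rightarrow> complex) \<Rightarrow> real \<Rightarrow> complex" where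
  "opA x r = \<i> * complex_of_real r * x r"

definition domA :: "(real \<Rightarrow> complex) set" where
  "domA = {x \<in> carrier. opA x \<in> carrier}"

definition res :: "complex \<Rightarrow> (real \<Rightarrow> complex) \<Rightarrow> real \<Rightarrow> complex" where
  "res z x r = x r / (z - \<i> * complex_of_real r)"

lemma opA_add: "opA (x + y) = opA x + opA y"
  by (auto simp: opA_def algebra_simps)

lemma opA_scale: "opA (\<lambda>r. c * x r) = (\<lambda>r. c * opA x r)"
  by (auto simp: opA_def)

lemma pair_res:
  assumes \<psi>: "\<psi> \<in> \<Psi>" and z: "Re z \<noteq> 0"
  shows "pair \<psi> (res z x) = of_real (K / \<bar>Re z\<bar>) *
    pair (\<lambda>j. complex_of_real (\<bar>Re z\<bar> / K) * (\<psi> j / (z - \<i> * of_nat j))) x"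
proof -
  let ?S = "{j. \<psi> j \<noteq> 0}"
  have "pair \<psi> (res z x) = (\<Sum>j\<in>?S. \<psi> j / (z - \<i> * of_nat j) * x (real j))"
    unfolding pair_def res_def by (intro sum.cong) auto
  also have "\<dots> = pair (\<lambda>j. \<psi> j / (z - \<i> * of_nat j)) x"
    by (rule pair_eq[symmetric]) (use fin[OF \<psi>] in auto)
  finally show ?thesis unfolding pair_cmult using K z by simp
qed

lemma res_bound:
  assumes x: "x \<in> carrier" and z: "Re z \<noteq> 0"
  shows "res z x \<in> carrier" "nm (res z x) \<le> K / \<bar>Re z\<bar> * nm x"
proof -
  have *: "cmod (pair \<psi> (res z x)) \<le> K / \<bar>Re z\<bar> * nm x" if \<psi>: "\<psi> \<in> \<Psi>" for \<psi>
  proof -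
    have k: "0 \<le> K / \<bar>Re z\<bar>" using K by simp
    have "cmod (pair \<psi> (res z x)) = K / \<bar>Re z\<bar> *
        cmod (pair (\<lambda>j. complex_of_real (\<bar>Re z\<bar> / K) * (\<psi> j / (z - \<i> * of_nat j))) x)"
      unfolding pair_res[OF \<psi> z] norm_mult norm_of_real using k by (simp only: abs_of_nonneg)
    also have "\<dots> \<le> K / \<bar>Re z\<bar> * nm x"
      by (intro mult_left_mono pair_le x resolvent_mult \<psi> z k)
    finally show ?thesis .
  qed
  show "res z x \<in> carrier"
    by (rule carrierI[OF _ *]) (simp_all add: res_def carrier_off[OF x])
  show "nm (res z x) \<le> K / \<bar>Re z\<bar> * nm x"
    using * by (rule nm_least)
qed

lemma shift_nz: "Re z \<noteq> 0 \<Longrightarrow> z - \<i> * complex_of_real r \<noteq> 0"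
  by (auto simp: complex_eq_iff)

text \<open>The equation is solved pointwise, since \<open>z - \<i> * r\<close> vanishes for no real
  \<open>r\<close>. The solution is in the domain because \<open>opA (res z y)\<close> equals
  \<open>z\<close> times \<open>res z y\<close> minus \<open>y\<close>, a difference of vectors in
  \<open>carrier\<close>.\<close>

lemma bij_shift:
  assumes z: "Re z \<noteq> 0"
  shows "bij_betw (\<lambda>x. scl space z x - opA x) domA carrier"
    and "y \<in> carrier \<Longrightarrow> resolvent space domA opA z y = res z y"
proof -
  have res_in: "res z y \<in> domA" if y: "y \<in> carrier" for y
  proof -
    have "opA (res z y) = (\<lambda>r. z * res z y r) - y"
      using shift_nz[OF z] by (auto simp: fun_eq_iff opA_def res_def field_simps)
    then show ?thesis
      using res_bound[OF y z] carrier_diff[OF carrier_scale[OF res_bound(1)[OF y z], of z] y]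
      by (simp add: domA_def)
  qed
  have left: "scl space z x - opA x = y \<longleftrightarrow> x = res z y" for x y
    using shift_nz[OF z] by (auto simp: fun_eq_iff opA_def res_def field_simps)
  show bij: "bij_betw (\<lambda>x. scl space z x - opA x) domA carrier"
  proof (rule bij_betwI')
    fix x y assume "x \<in> domA" "y \<in> domA"
    show "(scl space z x - opA x = scl space z y - opA y) \<longleftrightarrow> x = y"
      using left by metis
  next
    fix x assume "x \<in> domA"
    then show "scl space z x - opA x \<in> carrier"
      by (auto simp: domA_def intro!: carrier_diff carrier_scale)
  next
    fix y assume "y \<in> carrier"
    then show "\<exists>x\<in>domA. y = scl space z x - opA x" using res_in left by metis
  qed
  show "resolvent space domA opA z y = res z y" if "y \<in> carrier"
    unfolding resolvent_def using bij left res_in[OF that]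
    by (intro inv_into_f_eq) (auto simp: bij_betw_def)
qed

lemma res_linear: "linear_on carrier (\<lambda>c x r. c * x r) (\<lambda>c x r. c * x r) (res z)"
  by (auto simp: linear_on_def res_def add_divide_distrib fun_eq_iff)

lemma resolvent_bounded:
  assumes z: "Re z \<noteq> 0"
  shows "bounded_operator space (resolvent space domA opA z)"
proof -
  have "linear_on carrier (\<lambda>c x r. c * x r) (\<lambda>c x r. c * x r) (resolvent space domA opA z)"
    using res_linear[of z] bij_shift(2)[OF z] carrier_add carrier_scale
    by (simp add: linear_on_def)
  then show ?thesis
    using res_bound[OF _ z] bij_shift(2)[OF z]
    by (auto simp: bounded_operator_def intro!: exI[of _ "K / \<bar>Re z\<bar>"])
qed

lemma Spec_imaginary: "Spec space domA opA \<subseteq> {z. Re z = 0}"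
  using bij_shift(1) resolvent_bounded by (auto simp: Spec_def resolvent_set_def)

lemma resolvent_norm:
  assumes z: "Re z \<noteq> 0"
  shows "operator_norm space (resolvent space domA opA z) \<le> K / \<bar>Re z\<bar>"
  unfolding operator_norm_def
proof (rule cSUP_least)
  show "{x \<in> vecs space. nrm space x \<le> 1} \<noteq> {}" using carrier_0 nm_0 by auto
next
  fix x assume x: "x \<in> {x \<in> vecs space. nrm space x \<le> 1}"
  then have "nm (resolvent space domA opA z x) \<le> K / \<bar>Re z\<bar> * nm x"
    using res_bound(2)[OF _ z] bij_shift(2)[OF z] by simp
  also have "\<dots> \<le> K / \<bar>Re z\<bar> * 1" using x K by (intro mult_left_mono) auto
  finally show "nrm space (resolvent space domA opA z x) \<le> K / \<bar>Re z\<bar>" by simp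
qed

lemma operator_in_opA: "operator_in space domA opA"
  unfolding operator_in_def
proof (intro conjI)
  have z: "opA 0 = 0" by (auto simp: opA_def)
  show "module.subspace (scl space) domA"
    unfolding space_simps module.subspace_def[OF module_fun]
    using carrier_0 carrier_add carrier_scale
    by (auto simp: domA_def z opA_add opA_scale simp del: plus_fun_apply)
qed (auto simp: domA_def linear_on_def opA_add opA_scale simp del: plus_fun_apply)

lemma closed_opA: "closed_operator space domA opA"
  unfolding closed_operator_def
proof (intro conjI operator_in_opA allI ballI impI)
  fix X x y assume x: "x \<in> vecs space" and y: "y \<in> vecs space"
    and *: "range X \<subseteq> domA \<and> norm_tendsto space X x sequentially \<and>
      norm_tendsto space (\<lambda>n. opA (X n)) y sequentially"
  then have X: "\<And>n. X n \<in> carrier" "\<And>n. opA (X n) \<in> carrier" by (auto simp: domA_def)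
  have eq: "opA x = y"
  proof
    fix r
    show "opA x r = y r"
    proof (cases "r \<in> \<nat>")
      case True
      then obtain j where r: "r = real j" by (auto elim: Nats_cases)
      have "(\<lambda>n. opA (X n) (real j)) \<longlonglongrightarrow> y (real j)"
        using * X y by (intro tendsto_coord) auto
      moreover have "(\<lambda>n. opA (X n) (real j)) \<longlonglongrightarrow> opA x (real j)"
        unfolding opA_def using * X x by (intro tendsto_intros tendsto_coord) auto
      ultimately show ?thesis unfolding r using LIMSEQ_unique by blast
    next
      case False
      then show ?thesis using x y carrier_off[of x] carrier_off[of y] by (simp add: opA_def)
    qed
  qed
  then show "x \<in> domA" "opA x = y" using x y by (auto simp: domA_def)
qed

lemma unit_domA: "unit j \<in> domA" and opA_unit: "opA (unit j) = (\<lambda>r. (\<i> * of_nat j) * unit j r)"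
proof -
  show 1: "opA (unit j) = (\<lambda>r. (\<i> * of_nat j) * unit j r)"
    by (auto simp: opA_def unit_def)
  show "unit j \<in> domA"
    using unit_carrier[of j] carrier_scale[OF unit_carrier] by (simp add: domA_def 1)
qed

lemma domA_sum: "finite S \<Longrightarrow> (\<And>i. i \<in> S \<Longrightarrow> X i \<in> domA) \<Longrightarrow> (\<Sum>i\<in>S. X i) \<in> domA"
proof (induction S rule: finite_induct)
  case empty
  have "opA 0 = 0" by (auto simp: opA_def)
  then show ?case using carrier_0 by (simp add: domA_def zero_fun_def)
next
  case (insert i S)
  then show ?case
    by (auto simp: domA_def opA_add carrier_add simp del: plus_fun_apply)
qed

lemma trunc_domA: "x \<in> carrier \<Longrightarrow> trunc n x \<in> domA"
  unfolding trunc_eq_sum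
  using unit_domA by (intro domA_sum) (auto simp: domA_def opA_scale carrier_scale)

lemma dense_domA: "densely_defined space domA"
  unfolding densely_defined_def
proof (intro ballI allI impI)
  fix x and e :: real assume x: "x \<in> vecs space" and e: "e > 0"
  then have "\<forall>\<^sub>F n in sequentially. nm (x - trunc n x) < e"
    using trunc_tendsto[of x] by (intro order_tendstoD(2)) auto
  then obtain n where "nm (x - trunc n x) < e" by (auto simp: eventually_sequentially)
  then show "\<exists>d\<in>domA. nrm space (x - d) < e" using trunc_domA x by auto
qed

text \<open>The unit vector is an eigenvector of the operator, so every coordinate of its orbit
  solves a scalar linear equation, though only with right derivatives. Multiplied by
  \<open>exp (- w * s)\<close>, the coordinate has right derivative zero and is therefore
  constant.\<close>

lemma semigroup_unit:
  assumes T: "one_parameter_semigroup space T" and gen: "generator_of space T domA opA"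
    and t: "0 \<le> t"
  shows "T t (unit j) = (\<lambda>r. exp (\<i> * of_nat j * of_real t) * unit j r)"
proof -
  define e where "e = unit j"
  define w where "w = \<i> * complex_of_real (real j)"
  have e: "e \<in> carrier" by (simp add: e_def unit_carrier)
  have we: "(\<lambda>r. w * e r) \<in> carrier" by (rule carrier_scale[OF e])
  have Tc: "T s x \<in> carrier" if "s \<ge> 0" "x \<in> carrier" for s x
    using T that by (auto simp: one_parameter_semigroup_def bounded_operator_def)
  have Tlin: "T s (x + y) = T s x + T s y" "T s (\<lambda>r. c * x r) = (\<lambda>r. c * T s x r)"
    if "s \<ge> 0" "x \<in> carrier" "y \<in> carrier" for s x y c
    using T that by (auto simp: one_parameter_semigroup_def bounded_operator_def linear_on_def
        simp del: plus_fun_apply)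
  have Tdiff: "T s (x - y) = T s x - T s y" if "s \<ge> 0" "x \<in> carrier" "y \<in> carrier" for s x y
    using Tlin(1)[of s "x - y" y] that carrier_diff by simp
  have Tb: "\<exists>C. \<forall>x\<in>carrier. nm (T s x) \<le> C * nm x" if "s \<ge> 0" for s
    using T that by (auto simp: one_parameter_semigroup_def bounded_operator_def)
  have Tadd: "T (s + h) e = T s (T h e)" if "s \<ge> 0" "h \<ge> 0" for s h
    using T that e by (auto simp: one_parameter_semigroup_def)
  have Tcont: "((\<lambda>s. nm (T s e - T t e)) \<longlongrightarrow> 0) (at t within {0..})" if "t \<ge> 0" for t
    using T that e by (auto simp: one_parameter_semigroup_def norm_tendsto_def)
  have T0: "T 0 e = e" using T e by (auto simp: one_parameter_semigroup_def)
  have d0: "((\<lambda>h. nm ((\<lambda>r. (1 / complex_of_real h) * (T h e - e) r) - (\<lambda>r. w * e r))) \<longlongrightarrow> 0) (at_right 0)"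
    using gen e we unit_domA[of j] opA_unit[of j]
    by (auto simp: generator_of_def norm_tendsto_def e_def w_def)
  have "T t e r = exp (w * of_real t) * e r" for r
  proof (cases "r \<in> \<nat>")
    case False
    then show ?thesis using carrier_off[OF Tc[OF t e]] carrier_off[OF e] by simp
  next
    case True
    then obtain l where r: "r = real l" by (auto elim: Nats_cases)
    obtain C where C: "C > 0" "\<And>x. x \<in> carrier \<Longrightarrow> cmod (x (real l)) \<le> C * nm x"
      using coord_bound[of l] by blast
    define g where "g s = T s e (real l)" for s
    have gcont: "continuous_on {0..t} g"
    proof -
      have "(g \<longlongrightarrow> g s) (at s within {0..})" if s: "s \<ge> 0" for s
      proof -
        have "((\<lambda>u. C * nm (T u e - T s e)) \<longlongrightarrow> 0) (at s within {0..})"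
          using tendsto_mult_right_zero[OF Tcont[OF s]] by blast
        then have "((\<lambda>u. g u - g s) \<longlongrightarrow> 0) (at s within {0..})"
        proof (rule Lim_null_comparison[rotated])
          show "\<forall>\<^sub>F u in at s within {0..}. cmod (g u - g s) \<le> C * nm (T u e - T s e)"
            unfolding eventually_at_filter
            by (intro always_eventually allI impI)
               (use C(2)[OF carrier_diff[OF Tc Tc]] s e in \<open>force simp: g_def\<close>)
        qed
        then show ?thesis by (simp add: LIM_zero_iff)
      qed
      then have "continuous_on {0..} g" by (simp add: continuous_on_def)
      then show ?thesis by (rule continuous_on_subset) auto
    qed
    define f where "f s = exp (- w * of_real s) * g s" for s
    have fcont: "continuous_on {0..t} f"
      unfolding f_def by (intro continuous_intros gcont)
    have rd: "((\<lambda>h. (f (s + h) - f s) / of_real h) \<longlongrightarrow> 0) (at_right 0)" if s: "s \<ge> 0" for s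
    proof -
      obtain M where M: "\<And>x. x \<in> carrier \<Longrightarrow> nm (T s x) \<le> M * nm x" using Tb[OF s] by blast
      let ?q = "\<lambda>h. (\<lambda>r. (1 / complex_of_real h) * (T h e - e) r) - (\<lambda>r. w * e r)"
      \<comment> \<open>By the semigroup law the difference quotient at \<open>s\<close> is
        \<open>T s\<close> applied to the one at \<open>0\<close>, so boundedness of
        \<open>T s\<close> carries the convergence at \<open>0\<close> over to
        \<open>s\<close>.\<close>
      have gd: "((\<lambda>h. (g (s + h) - g s) / of_real h - w * g s) \<longlongrightarrow> 0) (at_right 0)"
      proof (rule Lim_null_comparison)
        show "((\<lambda>h. C * (\<bar>M\<bar> * nm (?q h))) \<longlongrightarrow> 0) (at_right 0)"
          using tendsto_mult_right_zero[OF tendsto_mult_right_zero[OF d0]] by blast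
        show "\<forall>\<^sub>F h in at_right 0. cmod ((g (s + h) - g s) / of_real h - w * g s) \<le> C * (\<bar>M\<bar> * nm (?q h))"
          unfolding eventually_at_filter
        proof (intro always_eventually allI impI)
          fix h :: real assume "h \<noteq> 0" "h \<in> {0<..}"
          then have h: "h > 0" by simp
          have d: "T h e - e \<in> carrier" using h e Tc by (intro carrier_diff) auto
          have q1: "(\<lambda>r. (1 / complex_of_real h) * (T h e - e) r) \<in> carrier" by (rule carrier_scale[OF d])
          have q: "?q h \<in> carrier" by (rule carrier_diff[OF q1 we])
          have "T s (?q h) = (\<lambda>r. (1 / complex_of_real h) * (T s (T h e) - T s e) r) - (\<lambda>r. w * T s e r)"
            unfolding Tdiff[OF s q1 we] Tlin(2)[OF s d d] Tlin(2)[OF s e e]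
            using Tdiff[OF s Tc[of h, OF _ e] e] h by simp
          then have "T s (?q h) (real l) = (g (s + h) - g s) / of_real h - w * g s"
            using h s by (simp add: g_def Tadd)
          moreover have "cmod (T s (?q h) (real l)) \<le> C * nm (T s (?q h))"
            by (rule C(2)[OF Tc[OF s q]])
          moreover have "nm (T s (?q h)) \<le> \<bar>M\<bar> * nm (?q h)"
            using M[OF q] mult_right_mono[OF abs_ge_self nm_nonneg[OF q], of M] by linarith
          then have "C * nm (T s (?q h)) \<le> C * (\<bar>M\<bar> * nm (?q h))"
            using C by (intro mult_left_mono) auto
          ultimately show "cmod ((g (s + h) - g s) / of_real h - w * g s) \<le> C * (\<bar>M\<bar> * nm (?q h))"
            by simp
        qed
      qed
      have ed: "((\<lambda>h. (exp (- w * of_real h) - 1) / of_real h) \<longlongrightarrow> - w) (at_right 0)"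
      proof -
        have "((\<lambda>u. exp (- w * u)) has_field_derivative - w) (at 0)"
          by (auto intro!: derivative_eq_intros)
        then have "((\<lambda>u. (exp (- w * u) - 1) / u) \<longlongrightarrow> - w) (at 0)"
          by (simp add: DERIV_def)
        moreover have "filterlim complex_of_real (at 0) (at_right 0)"
          by (auto simp: filterlim_at eventually_at_filter intro!: tendsto_eq_intros)
        ultimately show ?thesis by (rule filterlim_compose)
      qed
      have gl: "((\<lambda>h. (g (s + h) - g s) / of_real h) \<longlongrightarrow> w * g s) (at_right 0)"
        using gd by (simp add: LIM_zero_iff)
      have e1: "((\<lambda>h. exp (- w * of_real h)) \<longlongrightarrow> exp (- w * of_real 0)) (at_right 0)"
        by (intro tendsto_intros)
      have "((\<lambda>h. exp (- w * of_real s) * (exp (- w * of_real h) * ((g (s + h) - g s) / of_real h)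
          + (exp (- w * of_real h) - 1) / of_real h * g s))
          \<longlongrightarrow> exp (- w * of_real s) * (exp (- w * of_real 0) * (w * g s) + (- w) * g s)) (at_right 0)"
        by (intro tendsto_intros gl ed e1)
      moreover have "exp (- w * of_real s) * (exp (- w * of_real h) * ((g (s + h) - g s) / of_real h)
          + (exp (- w * of_real h) - 1) / of_real h * g s) = (f (s + h) - f s) / of_real h" for h
      proof -
        have "exp (- w * of_real (s + h)) = exp (- w * of_real s) * exp (- w * of_real h)"
          by (simp add: exp_add[symmetric] algebra_simps)
        then show ?thesis
          by (simp add: f_def algebra_simps add_divide_distrib diff_divide_distrib)
      qed
      ultimately show ?thesis by simp
    qed
    have "f t = f 0"
    proof (rule right_derivative_zero_constant[OF t fcont])
      fix s e' :: real assume s: "0 \<le> s" and e': "0 < e'"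
      from rd[OF s] e' have "\<forall>\<^sub>F h in at_right 0. cmod ((f (s + h) - f s) / of_real h) < e'"
        using tendstoD[OF rd[OF s] e'] by simp
      then obtain d where d: "d > 0" "\<And>h. 0 < h \<Longrightarrow> h < d \<Longrightarrow> cmod ((f (s + h) - f s) / of_real h) < e'"
        unfolding eventually_at_right_field by auto
      then show "\<exists>d>0. \<forall>h. 0 < h \<longrightarrow> h < d \<longrightarrow> norm (f (s + h) - f s) \<le> e' * h"
        by (intro exI[of _ d]) (auto simp: norm_divide field_simps less_imp_le)
    qed
    then have "exp (- w * of_real t) * g t = e (real l)" by (simp add: f_def g_def T0)
    then have "exp (w * of_real t) * (exp (- w * of_real t) * g t) = exp (w * of_real t) * e (real l)"
      by simp
    moreover have "exp (w * of_real t) * (exp (- w * of_real t) * g t) = g t"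
      by (simp add: exp_minus)
    ultimately show ?thesis by (simp add: r g_def)
  qed
  then show ?thesis by (simp add: e_def w_def fun_eq_iff)
qed

end

section \<open>Interpolation between square sums and bounded variation\<close>

definition variation :: "nat \<Rightarrow> nat \<Rightarrow> (nat \<Rightarrow> complex) \<Rightarrow> real" where
  "variation l u \<phi> = (\<Sum>j\<in>{l..<u}. cmod (\<phi> j - \<phi> (Suc j)))"

text \<open>Summation by parts: partial sums of the signs have modulus at most 1, and
  \<open>\<phi> u = 0\<close> removes the boundary term.\<close>

lemma norm_sum_alternating_le:
  fixes \<phi> :: "nat \<Rightarrow> complex"
  assumes u: "\<phi> u = 0"
  shows "cmod (\<Sum>j\<in>{l..<u}. (-1) ^ j * \<phi> j) \<le> variation l u \<phi>"
proof (cases "l \<le> u")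
  case True
  define S :: "nat \<Rightarrow> complex" where "S n = (\<Sum>j\<in>{l..<n}. (-1) ^ j)" for n
  have S_val: "S (l + d) = (if even d then 0 else (-1) ^ l)" for d
    by (induction d) (auto simp: S_def power_add)
  have S1: "cmod (S n) \<le> 1" if "l \<le> n" for n
    using S_val[of "n - l"] that by (simp add: norm_power)
  have "(\<Sum>j\<in>{l..<l + d}. (-1) ^ j * \<phi> j)
      = \<phi> (l + d) * S (l + d) + (\<Sum>j\<in>{l..<l + d}. (\<phi> j - \<phi> (Suc j)) * S (Suc j))" for d
  proof (induction d)
    case (Suc d)
    have "S (Suc (l + d)) = S (l + d) + (-1) ^ (l + d)" by (simp add: S_def)
    then show ?case using Suc by (simp add: algebra_simps)
  qed (simp add: S_def)
  from this[of "u - l"] True u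
  have "(\<Sum>j\<in>{l..<u}. (-1) ^ j * \<phi> j) = (\<Sum>j\<in>{l..<u}. (\<phi> j - \<phi> (Suc j)) * S (Suc j))" by simp
  also have "cmod \<dots> \<le> variation l u \<phi>"
    unfolding variation_def
  proof (rule order_trans[OF norm_sum], rule sum_mono)
    fix j assume "j \<in> {l..<u}"
    then have "cmod (\<phi> j - \<phi> (Suc j)) * cmod (S (Suc j)) \<le> cmod (\<phi> j - \<phi> (Suc j)) * 1"
      by (intro mult_left_mono S1) auto
    then show "cmod ((\<phi> j - \<phi> (Suc j)) * S (Suc j)) \<le> cmod (\<phi> j - \<phi> (Suc j))"
      by (simp add: norm_mult)
  qed
  finally show ?thesis .
qed (simp add: variation_def)

text \<open>The left side is the sine of the angle on the right.\<close>

lemma diff_div_sqrt_le_arctan: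
  assumes "x \<le> (y::real)"
  shows "(y - x) / (sqrt (1 + x\<^sup>2) * sqrt (1 + y\<^sup>2)) \<le> arctan y - arctan x"
proof -
  have "(y - x) / (sqrt (1 + x\<^sup>2) * sqrt (1 + y\<^sup>2)) = sin (arctan y - arctan x)"
    by (simp add: sin_diff sin_arctan cos_arctan diff_divide_distrib mult.commute)
  also have "\<dots> \<le> arctan y - arctan x"
    using assms by (intro sin_x_le_x) (simp add: arctan_le_iff)
  finally show ?thesis .
qed

text \<open>With \<open>x j\<close> the position of \<open>j\<close> relative to \<open>Im z\<close>
  in units of \<open>\<bar>Re z\<bar>\<close>, each summand is at most an increment of
  \<open>arctan\<close> divided by \<open>\<bar>Re z\<bar>\<close>. The increments telescope, and
  the range of \<open>arctan\<close> has length \<open>pi\<close>.\<close>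

lemma sum_resolvent_differences:
  assumes z: "Re z \<noteq> 0"
  shows "(\<Sum>j\<in>{l..<u}. cmod (1 / (z - \<i> * of_nat j) - 1 / (z - \<i> * of_nat (Suc j)))) \<le> pi / \<bar>Re z\<bar>"
proof (cases "l \<le> u")
  case True
  define a where "a = \<bar>Re z\<bar>"
  have a: "a > 0" using z by (simp add: a_def)
  define x where "x j = (real j - Im z) / a" for j
  have nz: "z - \<i> * of_nat j \<noteq> 0" for j using z by (auto simp: complex_eq_iff)
  have nrm: "cmod (z - \<i> * of_nat j) = a * sqrt (1 + (x j)\<^sup>2)" for j
  proof -
    have "cmod (z - \<i> * of_nat j) = sqrt (a\<^sup>2 * (1 + (x j)\<^sup>2))"
      using a by (simp add: cmod_def a_def x_def field_simps power2_commute)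
    then show ?thesis using a by (simp add: real_sqrt_mult)
  qed
  have step: "cmod (1 / (z - \<i> * of_nat j) - 1 / (z - \<i> * of_nat (Suc j)))
      \<le> (arctan (x (Suc j)) - arctan (x j)) / a" for j
  proof -
    have "1 / (z - \<i> * of_nat j) - 1 / (z - \<i> * of_nat (Suc j))
        = - \<i> / ((z - \<i> * of_nat j) * (z - \<i> * of_nat (Suc j)))"
      using nz[of j] nz[of "Suc j"] by (simp add: divide_simps) (simp add: algebra_simps)
    then have "cmod (1 / (z - \<i> * of_nat j) - 1 / (z - \<i> * of_nat (Suc j)))
        = 1 / ((a * sqrt (1 + (x j)\<^sup>2)) * (a * sqrt (1 + (x (Suc j))\<^sup>2)))"
      by (simp only: nrm[symmetric] norm_divide norm_mult norm_minus_cancel norm_ii)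
    also have "\<dots> = ((x (Suc j) - x j) / (sqrt (1 + (x j)\<^sup>2) * sqrt (1 + (x (Suc j))\<^sup>2))) / a"
    proof -
      have "x (Suc j) - x j = 1 / a" by (simp add: x_def diff_divide_distrib[symmetric])
      then show ?thesis by (simp add: ac_simps)
    qed
    also have "\<dots> \<le> (arctan (x (Suc j)) - arctan (x j)) / a"
      using a by (intro divide_right_mono diff_div_sqrt_le_arctan) (simp_all add: x_def divide_right_mono)
    finally show ?thesis .
  qed
  have "(\<Sum>j\<in>{l..<u}. cmod (1 / (z - \<i> * of_nat j) - 1 / (z - \<i> * of_nat (Suc j))))
      \<le> (\<Sum>j\<in>{l..<u}. (arctan (x (Suc j)) - arctan (x j)) / a)"
    by (intro sum_mono step)
  also have "\<dots> = (arctan (x u) - arctan (x l)) / a"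
    using True sum_Suc_diff'[of l u "\<lambda>j. arctan (x j)"] by (simp add: sum_divide_distrib[symmetric])
  also have "\<dots> \<le> pi / a"
    using a arctan_ubound[of "x u"] arctan_lbound[of "x l"] by (intro divide_right_mono) auto
  finally show ?thesis by (simp add: a_def)
qed simp

lemma variation_nonneg: "0 \<le> variation l u \<phi>"
  by (simp add: variation_def sum_nonneg)

lemma norm_le_variation:
  assumes "\<phi> u = 0" "l \<le> j" "j \<le> u"
  shows "cmod (\<phi> j) \<le> variation l u \<phi>"
proof -
  have "\<phi> j = (\<Sum>i\<in>{j..<u}. \<phi> i - \<phi> (Suc i))"
    using sum_Suc_diff'[of j u "\<lambda>i. - \<phi> i"] assms by simp
  then have "cmod (\<phi> j) \<le> (\<Sum>i\<in>{j..<u}. cmod (\<phi> i - \<phi> (Suc i)))" by (metis norm_sum)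
  also have "\<dots> \<le> variation l u \<phi>"
    unfolding variation_def using assms by (intro sum_mono2) auto
  finally show ?thesis .
qed

text \<open>A discrete product rule. The zero at \<open>u\<close> lets the variation of
  \<open>\<phi>\<close> also bound its values, which multiply the differences of
  \<open>m\<close>.\<close>

lemma variation_mult:
  assumes "\<phi> u = 0" and m: "\<And>j. j \<in> {l..<u} \<Longrightarrow> cmod (m j) \<le> B"
  shows "variation l u (\<lambda>j. m j * \<phi> j) \<le> (B + variation l u m) * variation l u \<phi>"
proof -
  have "variation l u (\<lambda>j. m j * \<phi> j)
      \<le> (\<Sum>j\<in>{l..<u}. B * cmod (\<phi> j - \<phi> (Suc j)) + cmod (m j - m (Suc j)) * variation l u \<phi>)"
    unfolding variation_def[of _ _ "\<lambda>j. m j * \<phi> j"]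
  proof (rule sum_mono)
    fix j assume j: "j \<in> {l..<u}"
    have "m j * \<phi> j - m (Suc j) * \<phi> (Suc j)
        = m j * (\<phi> j - \<phi> (Suc j)) + (m j - m (Suc j)) * \<phi> (Suc j)"
      by (simp add: algebra_simps)
    then have "cmod (m j * \<phi> j - m (Suc j) * \<phi> (Suc j))
        \<le> cmod (m j) * cmod (\<phi> j - \<phi> (Suc j)) + cmod (m j - m (Suc j)) * cmod (\<phi> (Suc j))"
      by (metis norm_mult norm_triangle_ineq)
    also have "\<dots> \<le> B * cmod (\<phi> j - \<phi> (Suc j)) + cmod (m j - m (Suc j)) * variation l u \<phi>"
      using j assms by (intro add_mono mult_right_mono mult_left_mono norm_le_variation) auto
    finally show "cmod (m j * \<phi> j - m (Suc j) * \<phi> (Suc j))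
        \<le> B * cmod (\<phi> j - \<phi> (Suc j)) + cmod (m j - m (Suc j)) * variation l u \<phi>" .
  qed
  also have "\<dots> = (B + variation l u m) * variation l u \<phi>"
    by (simp add: sum.distrib sum_distrib_left[symmetric] sum_distrib_right[symmetric]
        variation_def[symmetric] distrib_right)
  finally show ?thesis .
qed

text \<open>
  On one block, \<open>gauge p l u r\<close> is the ball of radius \<open>r\<close> of the real interpolation space between \<open>\<ell>\<^sup>2\<close>
  and \<open>variation\<close>, with parameters \<open>\<theta> = 1/(p+1)\<close> and \<open>\<infinity>\<close>: there is a splitting with
  \<open>\<parallel>\<phi>0\<parallel> \<le> r t\<^sup>\<theta>\<close> and \<open>variation \<phi>1 \<le> r t\<^sup>\<theta> / t\<close> for all \<open>t > 0\<close>.  Writing \<open>s = t\<^sup>\<theta>\<close>, only integer powers occur.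
  The condition \<open>\<phi>1 u = 0\<close> makes \<open>variation\<close> count the jump at the right end of the block.
\<close>

definition gauge :: "nat \<Rightarrow> nat \<Rightarrow> nat \<Rightarrow> real \<Rightarrow> (nat \<Rightarrow> complex) \<Rightarrow> bool" where
  "gauge p l u r \<psi> \<longleftrightarrow> (\<forall>s>0. \<exists>\<phi>0 \<phi>1. (\<forall>j\<in>{l..<u}. \<psi> j = \<phi>0 j + \<phi>1 j) \<and> \<phi>1 u = 0 \<and>
     L2_set (\<lambda>j. cmod (\<phi>0 j)) {l..<u} \<le> r * s \<and> variation l u \<phi>1 * s ^ p \<le> r)"

lemma gauge_cong: "gauge p l u r \<psi> \<Longrightarrow> (\<And>j. j \<in> {l..<u} \<Longrightarrow> \<psi>' j = \<psi> j) \<Longrightarrow> gauge p l u r \<psi>'"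
  unfolding gauge_def by fastforce

lemma gauge_zero: "0 \<le> r \<Longrightarrow> (\<And>j. j \<in> {l..<u} \<Longrightarrow> \<psi> j = 0) \<Longrightarrow> gauge p l u r \<psi>"
  unfolding gauge_def
  by (intro allI impI exI[of _ "\<lambda>_. 0"]) (simp add: variation_def L2_set_def)

text \<open>Exactness of the interpolation. The multiplier costs \<open>B\<close> on the
  square-summable part and \<open>B * (1 + L)\<close> on the variation part. Splitting at the
  dilated parameter \<open>s * D\<close> balances this: the first part loses a factor
  \<open>D\<close>, the second \<open>D ^ Suc p\<close> but regains \<open>D ^ p\<close>.\<close>

lemma gauge_mult:
  assumes g: "gauge p l u r \<psi>" and B: "0 \<le> B" "\<And>j. j \<in> {l..<u} \<Longrightarrow> cmod (m j) \<le> B"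
    and var: "variation l u m \<le> B * L" and D: "0 < D" "1 + L \<le> D ^ Suc p"
  shows "gauge p l u (B * D * r) (\<lambda>j. m j * \<psi> j)"
  unfolding gauge_def
proof (intro allI impI)
  fix s :: real assume s: "s > 0"
  obtain \<phi>0 \<phi>1 where \<phi>: "\<And>j. j \<in> {l..<u} \<Longrightarrow> \<psi> j = \<phi>0 j + \<phi>1 j" "\<phi>1 u = 0"
    "L2_set (\<lambda>j. cmod (\<phi>0 j)) {l..<u} \<le> r * (s * D)" "variation l u \<phi>1 * (s * D) ^ p \<le> r"
    using g[unfolded gauge_def, rule_format, of "s * D"] s D(1) by auto
  have "L2_set (\<lambda>j. cmod (m j * \<phi>0 j)) {l..<u} \<le> L2_set (\<lambda>j. B * cmod (\<phi>0 j)) {l..<u}"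
    using B by (intro L2_set_mono) (auto simp: norm_mult intro: mult_right_mono)
  also have "\<dots> = B * L2_set (\<lambda>j. cmod (\<phi>0 j)) {l..<u}"
    using B(1) by (simp add: L2_set_right_distrib)
  also have "\<dots> \<le> B * (r * (s * D))" by (intro mult_left_mono \<phi> B)
  finally have 1: "L2_set (\<lambda>j. cmod (m j * \<phi>0 j)) {l..<u} \<le> B * D * r * s" by (simp add: ac_simps)
  have "variation l u (\<lambda>j. m j * \<phi>1 j) \<le> (B + variation l u m) * variation l u \<phi>1"
    using variation_mult[of \<phi>1 u l m B] \<phi>(2) B(2) by blast
  also have "\<dots> \<le> (B * (1 + L)) * variation l u \<phi>1"
    using var by (intro mult_right_mono variation_nonneg) (simp add: algebra_simps)
  also have "\<dots> \<le> (B * D ^ Suc p) * variation l u \<phi>1"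
    using D B by (intro mult_right_mono mult_left_mono variation_nonneg)
  finally have "variation l u (\<lambda>j. m j * \<phi>1 j) * s ^ p \<le> (B * D ^ Suc p) * variation l u \<phi>1 * s ^ p"
    using s by (intro mult_right_mono) auto
  also have "\<dots> = (B * D) * (variation l u \<phi>1 * (s * D) ^ p)"
    by (simp add: power_mult_distrib ac_simps)
  also have "\<dots> \<le> (B * D) * r" using B D \<phi>(4) by (intro mult_left_mono) auto
  finally have 2: "variation l u (\<lambda>j. m j * \<phi>1 j) * s ^ p \<le> B * D * r" .
  show "\<exists>\<phi>0 \<phi>1. (\<forall>j\<in>{l..<u}. m j * \<psi> j = \<phi>0 j + \<phi>1 j) \<and> \<phi>1 u = 0 \<and>
     L2_set (\<lambda>j. cmod (\<phi>0 j)) {l..<u} \<le> B * D * r * s \<and> variation l u \<phi>1 * s ^ p \<le> B * D * r"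
    using \<phi>(1,2) 1 2
    by (intro exI[of _ "\<lambda>j. m j * \<phi>0 j"] exI[of _ "\<lambda>j. m j * \<phi>1 j"]) (auto simp: algebra_simps)
qed

lemma gauge_scale: "gauge p l u r \<psi> \<Longrightarrow> gauge p l u (cmod c * r) (\<lambda>j. c * \<psi> j)"
  using gauge_mult[of p l u r \<psi> "cmod c" "\<lambda>_. c" 0 1] by (simp add: variation_def)

lemma gauge_mono:
  assumes "gauge p l u r \<psi>" "r \<le> r'"
  shows "gauge p l u r' \<psi>"
  unfolding gauge_def
proof (intro allI impI)
  fix s :: real assume s: "s > 0"
  then have "r * s \<le> r' * s" using assms(2) by (simp add: mult_right_mono)
  then show "\<exists>\<phi>0 \<phi>1. (\<forall>j\<in>{l..<u}. \<psi> j = \<phi>0 j + \<phi>1 j) \<and> \<phi>1 u = 0 \<and>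
     L2_set (\<lambda>j. cmod (\<phi>0 j)) {l..<u} \<le> r' * s \<and> variation l u \<phi>1 * s ^ p \<le> r'"
    using assms(1)[unfolded gauge_def, rule_format, OF s] assms(2) by (meson order_trans)
qed

text \<open>The splitting at parameter 1 bounds each part by \<open>r\<close>. In particular radius
  0 forces the block to vanish, which is how zero weights yield finite support.\<close>

lemma gauge_bound:
  assumes g: "gauge p l u r \<psi>" and j: "j \<in> {l..<u}"
  shows "cmod (\<psi> j) \<le> 2 * r"
proof -
  obtain \<phi>0 \<phi>1 where \<phi>: "\<And>j. j \<in> {l..<u} \<Longrightarrow> \<psi> j = \<phi>0 j + \<phi>1 j" "\<phi>1 u = 0"
    "L2_set (\<lambda>j. cmod (\<phi>0 j)) {l..<u} \<le> r" "variation l u \<phi>1 \<le> r"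
    using g[unfolded gauge_def, rule_format, of 1] by auto
  have "cmod (\<phi>0 j) \<le> L2_set (\<lambda>j. cmod (\<phi>0 j)) {l..<u}"
    using j by (intro member_le_L2_set) auto
  moreover have "cmod (\<phi>1 j) \<le> variation l u \<phi>1"
    using j \<phi>(2) by (intro norm_le_variation) auto
  ultimately show ?thesis
    using \<phi> j norm_triangle_ineq[of "\<phi>0 j" "\<phi>1 j"] by simp
qed

text \<open>One part alone suffices at each parameter: the square-summable one from \<open>t\<close>
  on, the variation one below \<open>t\<close>, where the only jump is \<open>c\<close> at the right
  end.\<close>

lemma gauge_const:
  assumes c: "c \<ge> 0" "t > 0" "c * sqrt (real (u - l)) \<le> t" "c * t ^ p \<le> 1" and lu: "l < u"
  shows "gauge p l u 1 (\<lambda>j. if j \<in> {l..<u} then of_real c else 0)" (is "gauge p l u 1 ?\<psi>")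
  unfolding gauge_def
proof (intro allI impI)
  fix s :: real assume s: "s > 0"
  show "\<exists>\<phi>0 \<phi>1. (\<forall>j\<in>{l..<u}. ?\<psi> j = \<phi>0 j + \<phi>1 j) \<and> \<phi>1 u = 0 \<and>
     L2_set (\<lambda>j. cmod (\<phi>0 j)) {l..<u} \<le> 1 * s \<and> variation l u \<phi>1 * s ^ p \<le> 1"
  proof (cases "t \<le> s")
    case True
    have "L2_set (\<lambda>j. cmod (?\<psi> j)) {l..<u} = c * sqrt (real (u - l))"
      using c(1) by (simp add: L2_set_def real_sqrt_mult)
    then show ?thesis using True c
      by (intro exI[of _ ?\<psi>] exI[of _ "\<lambda>_. 0"]) (auto simp: variation_def)
  next
    case False
    have "variation l u ?\<psi> = (\<Sum>j\<in>{l..<u}. if j = u - 1 then c else 0)"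
      unfolding variation_def using c(1) by (intro sum.cong) auto
    also have "\<dots> = c" using lu by (subst sum.delta) auto
    finally have "variation l u ?\<psi> * s ^ p \<le> c * t ^ p"
      using False s c by (auto intro!: mult_left_mono power_mono)
    then show ?thesis using c s
      by (intro exI[of _ "\<lambda>_. 0"] exI[of _ ?\<psi>]) (auto simp: L2_set_def)
  qed
qed

text \<open>The height is \<open>1 / 2\<close> because an isolated entry causes up to two jumps; its
  variation is then at most 1.\<close>

lemma gauge_single:
  assumes j: "j \<in> {l..<u}"
  shows "gauge p l u 1 (single j (1 / 2))"
  unfolding gauge_def
proof (intro allI impI)
  fix s :: real assume s: "s > 0"
  let ?\<psi> = "single j (1 / 2)"
  have u: "?\<psi> u = 0" using j by (simp add: single_def)
  show "\<exists>\<phi>0 \<phi>1. (\<forall>j\<in>{l..<u}. ?\<psi> j = \<phi>0 j + \<phi>1 j) \<and> \<phi>1 u = 0 \<and>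
     L2_set (\<lambda>j. cmod (\<phi>0 j)) {l..<u} \<le> 1 * s \<and> variation l u \<phi>1 * s ^ p \<le> 1"
  proof (cases "1 \<le> s")
    case True
    have "L2_set (\<lambda>i. cmod (?\<psi> i)) {l..<u} \<le> (\<Sum>i\<in>{l..<u}. cmod (?\<psi> i))"
      by (intro L2_set_le_sum) auto
    also have "\<dots> = (\<Sum>i\<in>{l..<u}. if i = j then 1 / 2 else 0)"
      by (intro sum.cong) (auto simp: single_def)
    also have "\<dots> \<le> s" using True by (subst sum.delta) auto
    finally show ?thesis using u
      by (intro exI[of _ ?\<psi>] exI[of _ "\<lambda>_. 0"]) (auto simp: variation_def)
  next
    case False
    \<comment> \<open>For \<open>j = 0\<close> the truncated difference \<open>j - 1\<close> is
      \<open>0\<close> again, which only enlarges the majorant.\<close>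
    have "variation l u ?\<psi> \<le> (\<Sum>i\<in>{l..<u}. (if i = j then 1 / 2 else 0) + (if i = j - 1 then 1 / 2 else 0))"
      unfolding variation_def by (intro sum_mono) (auto simp: single_def)
    also have "\<dots> \<le> 1 / 2 + 1 / 2"
      unfolding sum.distrib by (intro add_mono) (auto simp: sum.delta)
    finally have "variation l u ?\<psi> * s ^ p \<le> 1 * 1"
      using False s by (intro mult_mono power_le_one) auto
    then show ?thesis using u s
      by (intro exI[of _ "\<lambda>_. 0"] exI[of _ ?\<psi>]) (auto simp: L2_set_def)
  qed
qed

text \<open>Cauchy-Schwarz handles the square-summable part, summation by parts the variation part;
  \<open>s\<close> stays free to balance the two.\<close>

lemma gauge_alternating:
  assumes g: "gauge p l u 1 \<psi>" and s: "s > 0"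
  shows "cmod (\<Sum>j\<in>{l..<u}. (-1) ^ j * \<psi> j) \<le> sqrt (real (u - l)) * s + 1 / s ^ p"
proof -
  obtain \<phi>0 \<phi>1 where \<phi>: "\<And>j. j \<in> {l..<u} \<Longrightarrow> \<psi> j = \<phi>0 j + \<phi>1 j" "\<phi>1 u = 0"
    "L2_set (\<lambda>j. cmod (\<phi>0 j)) {l..<u} \<le> s" "variation l u \<phi>1 * s ^ p \<le> 1"
    using g[unfolded gauge_def, rule_format, of s] s by auto
  have "(\<Sum>j\<in>{l..<u}. (-1) ^ j * \<psi> j)
      = (\<Sum>j\<in>{l..<u}. (-1) ^ j * \<phi>0 j) + (\<Sum>j\<in>{l..<u}. (-1) ^ j * \<phi>1 j)"
    by (simp add: \<phi>(1) sum.distrib algebra_simps)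
  then have "cmod (\<Sum>j\<in>{l..<u}. (-1) ^ j * \<psi> j)
      \<le> cmod (\<Sum>j\<in>{l..<u}. (-1) ^ j * \<phi>0 j) + cmod (\<Sum>j\<in>{l..<u}. (-1) ^ j * \<phi>1 j)"
    by (metis norm_triangle_ineq)
  also have "cmod (\<Sum>j\<in>{l..<u}. (-1) ^ j * \<phi>0 j) \<le> (\<Sum>j\<in>{l..<u}. \<bar>1\<bar> * \<bar>cmod (\<phi>0 j)\<bar>)"
    by (rule order_trans[OF norm_sum]) (simp add: norm_mult norm_power)
  also have "\<dots> \<le> L2_set (\<lambda>_. 1) {l..<u} * L2_set (\<lambda>j. cmod (\<phi>0 j)) {l..<u}"
    by (rule L2_set_mult_ineq)
  also have "\<dots> \<le> sqrt (real (u - l)) * s"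
    using \<phi>(3) by (intro mult_mono) (auto simp: L2_set_def intro: sum_nonneg)
  also have "cmod (\<Sum>j\<in>{l..<u}. (-1) ^ j * \<phi>1 j) \<le> variation l u \<phi>1"
    by (rule norm_sum_alternating_le[of \<phi>1 u, OF \<phi>(2)])
  also have "variation l u \<phi>1 \<le> 1 / s ^ p" using \<phi>(4) s by (simp add: field_simps)
  finally show ?thesis by simp
qed

section \<open>The \<open>\<ell>\<^sup>2\<close>-sum of the blocks\<close>

text \<open>Block sizes are powers with exponent \<open>2 * Suc p\<close>, so that their square
  roots and their powers with exponent \<open>1 / (p + 1)\<close> are natural numbers. They grow
  without bound.\<close>

definition cut :: "nat \<Rightarrow> nat \<Rightarrow> nat" where
  "cut p m = (\<Sum>i<m. Suc i ^ (2 * Suc p))"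

lemma cut_Suc: "cut p (Suc m) = cut p m + Suc m ^ (2 * Suc p)"
  by (simp add: cut_def)

lemma cut_less_Suc: "cut p m < cut p (Suc m)"
  by (simp add: cut_Suc)

lemma mono_cut: "mono (cut p)"
  using cut_less_Suc by (intro mono_iff_le_Suc[THEN iffD2]) (simp add: less_imp_le)

lemma le_cut: "m \<le> cut p m"
proof (induction m)
  case (Suc m)
  then show ?case using cut_less_Suc[of p m] by linarith
qed simp

abbreviation block :: "nat \<Rightarrow> nat \<Rightarrow> nat set" where
  "block p m \<equiv> {cut p m..<cut p (Suc m)}"

lemma block_exists: "\<exists>m. j \<in> block p m"
proof -
  have "j < cut p (Suc j)" using le_cut[of "Suc j" p] by simp
  then have ex: "\<exists>m. j < cut p (Suc m)" by blast
  define m where "m = (LEAST m. j < cut p (Suc m))"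
  have "j < cut p (Suc m)" unfolding m_def using LeastI_ex[OF ex] .
  moreover have "cut p m \<le> j"
  proof (cases m)
    case 0
    then show ?thesis by (simp add: cut_def)
  next
    case (Suc m')
    then have "m' < (LEAST m. j < cut p (Suc m))" by (simp add: m_def)
    then show ?thesis using not_less_Least[of m' "\<lambda>m. j < cut p (Suc m)"] Suc by simp
  qed
  ultimately show ?thesis by (intro exI[of _ m]) simp
qed

text \<open>Cut points never divide a block, so truncating a functional amounts to deleting
  weights.\<close>

lemma block_side:
  assumes "j \<in> block p m"
  shows "j < cut p n \<longleftrightarrow> m < n"
proof
  assume "j < cut p n"
  then have "cut p m < cut p n" using assms by simp
  then show "m < n" using mono_cut[of p] by (meson leD leI monoD)
next
  assume "m < n"
  then have "cut p (Suc m) \<le> cut p n" using mono_cut[of p] by (meson Suc_leI monoD)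
  then show "j < cut p n" using assms by simp
qed

lemma block_unique: "j \<in> block p m \<Longrightarrow> j \<in> block p n \<Longrightarrow> m = n"
  using block_side[of j p m "Suc n"] block_side[of j p n "Suc m"] by simp

text \<open>The weights \<open>a\<close> distribute a functional over the blocks of an \<open>\<ell>\<^sup>2\<close>-sum.\<close>

definition weights :: "nat \<Rightarrow> (nat \<Rightarrow> real) \<Rightarrow> nat \<Rightarrow> (nat \<Rightarrow> complex) \<Rightarrow> bool" where
  "weights p a M \<psi> \<longleftrightarrow> (\<forall>m. 0 \<le> a m) \<and> (\<forall>m\<ge>M. a m = 0) \<and>
     (\<forall>m. gauge p (cut p m) (cut p (Suc m)) (a m) \<psi>)"

text \<open>Weights that vanish from some block on make every member finitely supported, as
  \<open>pair\<close> requires.\<close>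

definition functionals :: "nat \<Rightarrow> (nat \<Rightarrow> complex) set" where
  "functionals p = {\<psi>. \<exists>a M. weights p a M \<psi> \<and> (\<Sum>m<M. (a m)\<^sup>2) \<le> 1}"

lemma weights_support:
  assumes "weights p a M \<psi>" "cut p M \<le> j"
  shows "\<psi> j = 0"
proof -
  obtain m where m: "j \<in> block p m" using block_exists by blast
  then have "M \<le> m" using assms(2) block_side[OF m, of M] by simp
  then have "gauge p (cut p m) (cut p (Suc m)) 0 \<psi>" using assms(1) by (metis weights_def)
  from gauge_bound[OF this m] show ?thesis by simp
qed

lemma functionalsE:
  assumes "\<psi> \<in> functionals p"
  obtains a M where "weights p a M \<psi>" "(\<Sum>m<M. (a m)\<^sup>2) \<le> 1"
  using assms unfolding functionals_def by blast

lemma functionals_gauge: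
  assumes "\<psi> \<in> functionals p"
  shows "gauge p (cut p n) (cut p (Suc n)) 1 \<psi>"
proof -
  obtain a M where w: "weights p a M \<psi>" and s: "(\<Sum>m<M. (a m)\<^sup>2) \<le> 1"
    using assms by (rule functionalsE)
  have "(a n)\<^sup>2 \<le> 1"
  proof (cases "n < M")
    case True
    then have "(a n)\<^sup>2 \<le> (\<Sum>m<M. (a m)\<^sup>2)" by (intro member_le_sum) auto
    then show ?thesis using s by simp
  qed (use w in \<open>simp add: weights_def\<close>)
  then have "a n \<le> 1" using power2_le_imp_le[of "a n" 1] by simp
  moreover have "gauge p (cut p n) (cut p (Suc n)) (a n) \<psi>" using w by (simp add: weights_def)
  ultimately show ?thesis by (rule gauge_mono[rotated])
qed

lemma weights_mono:
  assumes w: "weights p a M \<psi>" and "M \<le> N"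
  shows "weights p a N \<psi>" "(\<Sum>m<N. (a m)\<^sup>2) = (\<Sum>m<M. (a m)\<^sup>2)"
proof -
  show "weights p a N \<psi>" using assms by (auto simp: weights_def)
  have "a m = 0" if "m \<in> {..<N} - {..<M}" for m using w that by (simp add: weights_def)
  then show "(\<Sum>m<N. (a m)\<^sup>2) = (\<Sum>m<M. (a m)\<^sup>2)"
    using assms(2) by (intro sum.mono_neutral_right) auto
qed

lemma weights_scale:
  "weights p a M \<psi> \<Longrightarrow> weights p (\<lambda>m. cmod c * a m) M (\<lambda>j. c * \<psi> j)"
  by (simp add: weights_def gauge_scale)

lemma weights_piecewise:
  assumes "weights p a M \<psi>1" "weights p b M \<psi>2"
  shows "weights p (\<lambda>m. if m < n then a m else b m) M (\<lambda>j. if j < cut p n then \<psi>1 j else \<psi>2 j)"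
  unfolding weights_def
proof (intro conjI allI impI)
  fix m
  show "gauge p (cut p m) (cut p (Suc m)) (if m < n then a m else b m)
      (\<lambda>j. if j < cut p n then \<psi>1 j else \<psi>2 j)"
  proof (cases "m < n")
    case True
    then have "gauge p (cut p m) (cut p (Suc m)) (if m < n then a m else b m) \<psi>1"
      using assms by (simp add: weights_def)
    then show ?thesis by (rule gauge_cong) (use True in \<open>simp add: block_side del: atLeastLessThan_iff\<close>)
  next
    case False
    then have "gauge p (cut p m) (cut p (Suc m)) (if m < n then a m else b m) \<psi>2"
      using assms by (simp add: weights_def)
    then show ?thesis by (rule gauge_cong) (use False in \<open>simp add: block_side del: atLeastLessThan_iff\<close>)
  qed
qed (use assms in \<open>auto simp: weights_def\<close>)

lemma weights_zero: "weights p (\<lambda>_. 0) M (\<lambda>_. 0)"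
  by (simp add: weights_def gauge_zero)

text \<open>Division by \<open>R\<close> works unless \<open>R = 0\<close>; in that case all weights
  vanish and with them the sequence.\<close>

lemma functionals_normalize:
  assumes w: "weights p a M \<psi>" and R: "0 \<le> R" "(\<Sum>m<M. (a m)\<^sup>2) = R\<^sup>2"
  shows "\<exists>\<psi>'\<in>functionals p. \<forall>j. \<psi> j = of_real R * \<psi>' j"
proof (cases "R = 0")
  case True
  then have "a m = 0" if "m < M" for m
    using R that by (simp add: sum_nonneg_eq_0_iff)
  then have a0: "a m = 0" for m using w by (cases "m < M") (auto simp: weights_def)
  have "weights p a 0 \<psi>" using w a0 by (simp add: weights_def)
  then have "\<psi> j = 0" for j by (rule weights_support) (simp add: cut_def)
  moreover have "(\<lambda>_. 0) \<in> functionals p"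
    using weights_zero[of p 0] by (force simp: functionals_def)
  ultimately show ?thesis by force
next
  case False
  have "weights p (\<lambda>m. cmod (of_real (1 / R)) * a m) M (\<lambda>j. of_real (1 / R) * \<psi> j)"
    by (rule weights_scale[OF w])
  moreover have "(\<Sum>m<M. (cmod (of_real (1 / R)) * a m)\<^sup>2) = 1"
    using False R by (simp add: power_mult_distrib sum_distrib_left[symmetric] norm_divide power_divide
        flip: sum_divide_distrib)
  ultimately have "(\<lambda>j. of_real (1 / R) * \<psi> j) \<in> functionals p"
    unfolding functionals_def by force
  then show ?thesis using False by force
qed

lemma sum_piecewise_weights:
  fixes a b :: "nat \<Rightarrow> real"
  shows "(\<Sum>m<M. (if m < n then a m else b m)\<^sup>2)
    = (\<Sum>m<M. (if m < n then a m else 0)\<^sup>2) + (\<Sum>m<M. (if m < n then 0 else b m)\<^sup>2)"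
  unfolding sum.distrib[symmetric] by (intro sum.cong) auto

text \<open>For \<open>split\<close>, the squares of the coefficients are the sums of squared
  weights before and after the cut. For \<open>comb\<close>, the two families of weights are
  multiplied by the moduli of \<open>a\<close> and \<open>b\<close>, after extension to a common
  range.\<close>

lemma norming_functionals: "norming (functionals p) (cut p)"
proof
  fix \<psi> assume "\<psi> \<in> functionals p"
  then obtain a M where w: "weights p a M \<psi>" by (rule functionalsE)
  then have "{j. \<psi> j \<noteq> 0} \<subseteq> {..<cut p M}" using weights_support by (force simp: not_le)
  then show "finite {j. \<psi> j \<noteq> 0}" using finite_subset by blast
next
  fix j
  obtain n where n: "j \<in> block p n" using block_exists by blast
  have "weights p (\<lambda>m. if m = n then 1 else 0) (Suc n) (single j (1 / 2))"
    unfolding weights_def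
  proof (intro conjI allI impI)
    fix m
    show "gauge p (cut p m) (cut p (Suc m)) (if m = n then 1 else 0) (single j (1 / 2))"
    proof (cases "m = n")
      case True
      then show ?thesis using gauge_single[OF n] by simp
    next
      case False
      have "j \<notin> block p m"
        using False block_unique[OF n] by blast
      then show ?thesis using False by (intro gauge_zero) (auto simp: single_def)
    qed
  qed auto
  moreover have "(\<Sum>m<Suc n. (if m = n then 1 else 0 :: real)\<^sup>2) \<le> 1" by simp
  ultimately have "single j (1 / 2) \<in> functionals p" unfolding functionals_def by blast
  then show "\<exists>c. c \<noteq> 0 \<and> single j c \<in> functionals p" by (intro exI[of _ "1 / 2"]) simp
next
  fix j
  obtain n where n: "j \<in> block p n" using block_exists by blast
  have "cmod (\<psi> j) \<le> 2" if "\<psi> \<in> functionals p" for \<psi>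
    using gauge_bound[OF functionals_gauge[OF that] n] by simp
  then show "\<exists>C. \<forall>\<psi>\<in>functionals p. cmod (\<psi> j) \<le> C" by blast
next
  fix \<psi> n assume "\<psi> \<in> functionals p"
  then obtain a M where w: "weights p a M \<psi>" and s: "(\<Sum>m<M. (a m)\<^sup>2) \<le> 1"
    by (rule functionalsE)
  define A where "A = (\<Sum>m<M. (if m < n then a m else 0)\<^sup>2)"
  define B where "B = (\<Sum>m<M. (if m < n then 0 else a m)\<^sup>2)"
  have AB: "A \<ge> 0" "B \<ge> 0" "A + B \<le> 1"
    using s sum_piecewise_weights[where a = a and b = a and M = M and n = n]
    unfolding A_def[symmetric] B_def[symmetric]
    by (simp_all add: A_def B_def sum_nonneg)
  obtain \<psi>1 where 1: "\<psi>1 \<in> functionals p" "\<forall>j. (if j < cut p n then \<psi> j else 0) = of_real (sqrt A) * \<psi>1 j"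
    using functionals_normalize[OF weights_piecewise[OF w weights_zero], of "sqrt A" n] AB(1)
    unfolding A_def[symmetric] by auto
  obtain \<psi>2 where 2: "\<psi>2 \<in> functionals p" "\<forall>j. (if j < cut p n then 0 else \<psi> j) = of_real (sqrt B) * \<psi>2 j"
    using functionals_normalize[OF weights_piecewise[OF weights_zero w], of "sqrt B" n] AB(2)
    unfolding B_def[symmetric] by auto
  show "\<exists>a b \<psi>1 \<psi>2. 0 \<le> a \<and> 0 \<le> b \<and> a\<^sup>2 + b\<^sup>2 \<le> 1 \<and> \<psi>1 \<in> functionals p \<and> \<psi>2 \<in> functionals p \<and>
       (\<forall>j. (if j < cut p n then \<psi> j else 0) = complex_of_real a * \<psi>1 j) \<and>
       (\<forall>j. (if j < cut p n then 0 else \<psi> j) = complex_of_real b * \<psi>2 j)"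
    using 1 2 AB by (intro exI[of _ "sqrt A"] exI[of _ "sqrt B"] exI[of _ \<psi>1] exI[of _ \<psi>2]) simp
next
  fix \<psi>1 \<psi>2 a b n
  assume \<psi>1: "\<psi>1 \<in> functionals p" and \<psi>2: "\<psi>2 \<in> functionals p"
    and ab: "(cmod a)\<^sup>2 + (cmod b)\<^sup>2 \<le> 1"
  obtain a1 M1 where w1: "weights p a1 M1 \<psi>1" "(\<Sum>m<M1. (a1 m)\<^sup>2) \<le> 1"
    using \<psi>1 by (rule functionalsE)
  obtain a2 M2 where w2: "weights p a2 M2 \<psi>2" "(\<Sum>m<M2. (a2 m)\<^sup>2) \<le> 1"
    using \<psi>2 by (rule functionalsE)
  define M where "M = max M1 M2"
  have w': "weights p a1 M \<psi>1" "(\<Sum>m<M. (a1 m)\<^sup>2) \<le> 1" "weights p a2 M \<psi>2" "(\<Sum>m<M. (a2 m)\<^sup>2) \<le> 1"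
    using weights_mono[OF w1(1), of M] weights_mono[OF w2(1), of M] w1(2) w2(2) by (simp_all add: M_def)
  let ?c = "\<lambda>m. if m < n then cmod a * a1 m else cmod b * a2 m"
  have "weights p ?c M (\<lambda>j. if j < cut p n then a * \<psi>1 j else b * \<psi>2 j)"
    by (intro weights_piecewise weights_scale w')
  moreover have "(\<Sum>m<M. (?c m)\<^sup>2) \<le> 1"
  proof -
    have "(\<Sum>m<M. (?c m)\<^sup>2) \<le> (\<Sum>m<M. (cmod a)\<^sup>2 * (a1 m)\<^sup>2 + (cmod b)\<^sup>2 * (a2 m)\<^sup>2)"
      by (intro sum_mono) (auto simp: power_mult_distrib)
    also have "\<dots> = (cmod a)\<^sup>2 * (\<Sum>m<M. (a1 m)\<^sup>2) + (cmod b)\<^sup>2 * (\<Sum>m<M. (a2 m)\<^sup>2)"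
      by (simp add: sum.distrib sum_distrib_left)
    also have "\<dots> \<le> (cmod a)\<^sup>2 * 1 + (cmod b)\<^sup>2 * 1"
      by (intro add_mono mult_left_mono w') auto
    finally show ?thesis using ab by simp
  qed
  ultimately show "(\<lambda>j. if j < cut p n then a * \<psi>1 j else b * \<psi>2 j) \<in> functionals p"
    unfolding functionals_def by blast
next
  show "mono (cut p)" by (rule mono_cut)
next
  fix j
  show "\<exists>n. j < cut p n" using le_cut[of "Suc j" p] by (metis Suc_le_lessD)
qed

text \<open>On each block \<open>gauge_mult\<close> is used with
  \<open>B = 1 / \<bar>Re z\<bar>\<close>, \<open>L = pi\<close> and \<open>D = K\<close>; the
  factor \<open>\<bar>Re z\<bar> / K\<close> then restores the original weight, so the same weights
  serve.\<close>

lemma norming_resolvent_functionals: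
  assumes K: "0 < K" "1 + pi \<le> K ^ Suc p"
  shows "norming_resolvent (functionals p) (cut p) K"
proof -
  interpret norming "functionals p" "cut p" by (rule norming_functionals)
  show ?thesis
  proof
    fix \<psi> and z :: complex
    assume \<psi>: "\<psi> \<in> functionals p" and z: "Re z \<noteq> 0"
    obtain a M where w: "weights p a M \<psi>" "(\<Sum>m<M. (a m)\<^sup>2) \<le> 1"
      using \<psi> by (rule functionalsE)
    define m where "m j = 1 / (z - \<i> * of_nat j)" for j :: nat
    have mb: "cmod (m j) \<le> 1 / \<bar>Re z\<bar>" for j
      using z abs_Re_le_cmod[of "z - \<i> * of_nat j"]
      by (simp add: m_def norm_divide frac_le)
    have var: "variation l u m \<le> 1 / \<bar>Re z\<bar> * pi" for l u
      using sum_resolvent_differences[OF z, of l u] by (simp add: variation_def m_def)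
    have c: "cmod (complex_of_real (\<bar>Re z\<bar> / K)) * (1 / \<bar>Re z\<bar> * K * r) = r" for r
      using z K by (simp add: norm_divide)
    have "gauge p (cut p i) (cut p (Suc i)) (a i) (\<lambda>j. of_real (\<bar>Re z\<bar> / K) * (m j * \<psi> j))" for i
    proof -
      have g: "gauge p (cut p i) (cut p (Suc i)) (a i) \<psi>" using w(1) by (simp add: weights_def)
      have "gauge p (cut p i) (cut p (Suc i)) (1 / \<bar>Re z\<bar> * K * a i) (\<lambda>j. m j * \<psi> j)"
        by (rule gauge_mult[OF g _ mb var K]) simp
      from gauge_scale[OF this, of "of_real (\<bar>Re z\<bar> / K)"] show ?thesis unfolding c .
    qed
    then have "weights p a M (\<lambda>j. of_real (\<bar>Re z\<bar> / K) * (m j * \<psi> j))"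
      using w(1) by (simp add: weights_def)
    then have "weights p a M (\<lambda>j. of_real (\<bar>Re z\<bar> / K) * (\<psi> j / (z - \<i> * of_nat j)))"
      by (simp add: m_def)
    then show "(\<lambda>j. of_real (\<bar>Re z\<bar> / K) * (\<psi> j / (z - \<i> * of_nat j))) \<in> functionals p"
      using w(2) unfolding functionals_def by blast
  qed (rule K)
qed

section \<open>The operator at time \<open>pi\<close> and the contradiction on large blocks\<close>

context norming_resolvent begin

lemma pair_unit_sum:
  assumes "finite {j. \<psi> j \<noteq> 0}" "finite S"
  shows "pair \<psi> (\<Sum>j\<in>S. (\<lambda>r. c j * unit j r)) = (\<Sum>j\<in>S. c j * \<psi> j)"
  using assms(2)
proof (induction S rule: finite_induct)
  case empty
  then show ?case by (simp add: pair_def)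
next
  case (insert i S)
  then show ?case by (simp add: pair_add pair_scale pair_unit[OF assms(1)] del: plus_fun_apply)
qed

lemma unit_sum_carrier: "finite S \<Longrightarrow> (\<Sum>j\<in>S. (\<lambda>r. c j * unit j r)) \<in> carrier"
  by (intro carrier_sum carrier_scale unit_carrier)

lemma semigroup_unit_sum:
  assumes T: "one_parameter_semigroup space T" and gen: "generator_of space T domA opA"
    and t: "0 \<le> t" and S: "finite S"
  shows "T t (\<Sum>j\<in>S. (\<lambda>r. c j * unit j r)) = (\<Sum>j\<in>S. (\<lambda>r. (c j * exp (\<i> * of_nat j * of_real t)) * unit j r))"
  using S
proof (induction S rule: finite_induct)
  case empty
  have lin: "linear_on carrier (\<lambda>c x r. c * x r) (\<lambda>c x r. c * x r) (T t)"
    using T t by (simp add: one_parameter_semigroup_def bounded_operator_def)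
  then have "T t (0 + 0) = T t 0 + T t 0" using carrier_0 unfolding linear_on_def by blast
  then have "T t 0 = T t 0 + T t 0" by (simp only: add_0_left)
  then have "T t 0 = 0" by (simp only: add_cancel_right_right)
  then show ?case by (simp only: sum.empty)
next
  case (insert i S)
  have lin: "linear_on carrier (\<lambda>c x r. c * x r) (\<lambda>c x r. c * x r) (T t)"
    using T t by (simp add: one_parameter_semigroup_def bounded_operator_def)
  have "T t ((\<lambda>r. c i * unit i r) + (\<Sum>j\<in>S. (\<lambda>r. c j * unit j r)))
      = T t (\<lambda>r. c i * unit i r) + T t (\<Sum>j\<in>S. (\<lambda>r. c j * unit j r))"
    using lin unit_sum_carrier[OF insert(1)] carrier_scale[OF unit_carrier]
    unfolding linear_on_def by blast
  moreover have "T t (\<lambda>r. c i * unit i r) = (\<lambda>r. c i * T t (unit i) r)"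
    using lin unit_carrier unfolding linear_on_def by blast
  ultimately show ?case
    using insert semigroup_unit[OF T gen t, of i] by (simp add: mult.assoc del: plus_fun_apply)
qed

text \<open>At time \<open>pi\<close> the eigenvalue \<open>\<i> * j\<close> contributes
  \<open>(-1) ^ j\<close>, which cancels the signs; the bound of this single operator serves all
  finite \<open>S\<close>.\<close>

lemma semigroup_alternating_bound:
  assumes T: "one_parameter_semigroup space T" and gen: "generator_of space T domA opA"
  shows "\<exists>C. \<forall>S. finite S \<longrightarrow> nm (\<Sum>j\<in>S. unit j) \<le> C * nm (\<Sum>j\<in>S. (\<lambda>r. (-1) ^ j * unit j r))"
proof -
  have "bounded_operator space (T pi)" using T by (simp add: one_parameter_semigroup_def)
  then obtain C where C: "\<forall>x\<in>carrier. nm (T pi x) \<le> C * nm x"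
    by (auto simp: bounded_operator_def)
  have e: "exp (\<i> * of_nat j * of_real pi) = (-1) ^ j" for j
    using exp_of_nat_mult[of j "\<i> * of_real pi"] by (simp add: mult_ac)
  have "nm (\<Sum>j\<in>S. unit j) \<le> C * nm (\<Sum>j\<in>S. (\<lambda>r. (-1) ^ j * unit j r))" if "finite S" for S
  proof -
    have "T pi (\<Sum>j\<in>S. (\<lambda>r. (-1) ^ j * unit j r)) = (\<Sum>j\<in>S. unit j)"
      unfolding semigroup_unit_sum[OF T gen pi_ge_zero that] e
      by (simp flip: power_mult_distrib)
    then show ?thesis
      using bspec[OF C unit_sum_carrier[OF that, of "\<lambda>j. (-1) ^ j"]] by (simp only:)
  qed
  then show ?thesis by blast
qed

end

text \<open>With \<open>M = Suc n\<close>, block \<open>n\<close> has \<open>M ^ (2 * Suc p)\<close>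
  coordinates. On it the vector of ones has norm at least \<open>M ^ (p + 2)\<close> and the
  alternating one at most \<open>2 * M ^ p\<close>; the ratio of at least
  \<open>M\<^sup>2 / 2\<close> exceeds any fixed bound.\<close>

lemma not_generator:
  assumes "norming_resolvent (functionals p) (cut p) K"
  shows "\<not> (\<exists>T. one_parameter_semigroup (norming.space (functionals p)) T \<and>
     generator_of (norming.space (functionals p)) T (norming_resolvent.domA (functionals p)) norming_resolvent.opA)"
proof -
  interpret norming_resolvent "functionals p" "cut p" K by (rule assms)
  show ?thesis
  proof
    assume "\<exists>T. one_parameter_semigroup space T \<and> generator_of space T domA opA"
    then obtain C where C: "\<And>S. finite S \<Longrightarrow>
        nm (\<Sum>j\<in>S. unit j) \<le> C * nm (\<Sum>j\<in>S. (\<lambda>r. (-1) ^ j * unit j r))"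
      using semigroup_alternating_bound by metis
    obtain n where n: "2 * \<bar>C\<bar> < real n" using reals_Archimedean2 by blast
    define M where "M = real (Suc n)"
    have M: "M \<ge> 1" by (simp add: M_def)
    have size: "real (cut p (Suc n) - cut p n) = (M ^ Suc p)\<^sup>2"
      by (simp only: cut_Suc M_def add_diff_cancel_left' of_nat_power power_mult[symmetric] mult.commute)
    have sqrt_size: "sqrt (real (cut p (Suc n) - cut p n)) = M ^ Suc p"
      unfolding size using M by simp
    \<comment> \<open>The height is the largest that \<open>gauge_const\<close> allows at threshold
      \<open>M\<close>: both of its conditions hold with equality.\<close>
    define \<psi> where "\<psi> j = (if j \<in> block p n then complex_of_real (1 / M ^ p) else 0)" for j
    have "gauge p (cut p n) (cut p (Suc n)) 1 \<psi>"
      unfolding \<psi>_def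
      by (rule gauge_const[where t = M]) (use M sqrt_size cut_less_Suc in auto)
    moreover have "gauge p (cut p m) (cut p (Suc m)) 0 \<psi>" if "m \<noteq> n" for m
    proof (rule gauge_zero)
      fix j assume j: "j \<in> block p m"
      then have "j \<notin> block p n" using that block_unique[OF j] by blast
      then show "\<psi> j = 0" unfolding \<psi>_def by (rule if_not_P)
    qed simp
    ultimately have "weights p (\<lambda>m. if m = n then 1 else 0) (Suc n) \<psi>"
      unfolding weights_def by auto
    moreover have "(\<Sum>m<Suc n. (if m = n then 1 else 0 :: real)\<^sup>2) \<le> 1" by simp
    ultimately have \<psi>: "\<psi> \<in> functionals p" unfolding functionals_def by blast
    let ?x = "\<Sum>j\<in>block p n. unit j" and ?y = "\<Sum>j\<in>block p n. (\<lambda>r. (-1) ^ j * unit j r)"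
    have xc: "?x \<in> carrier" by (intro carrier_sum unit_carrier) simp
    have "pair \<psi> ?x = (\<Sum>j\<in>block p n. 1 * \<psi> j)"
      using pair_unit_sum[OF fin[OF \<psi>], of "block p n" "\<lambda>_. 1"] by simp
    also have "\<dots> = (\<Sum>j\<in>block p n. complex_of_real (1 / M ^ p))"
      by (intro sum.cong refl) (simp add: \<psi>_def)
    also have "\<dots> = of_real (real (cut p (Suc n) - cut p n) * (1 / M ^ p))"
      by simp
    also have "\<dots> = of_real (M ^ p * M\<^sup>2)"
      unfolding size using M by (simp add: power2_eq_square)
    finally have lower: "M ^ p * M\<^sup>2 \<le> nm ?x"
      using pair_le[OF xc \<psi>] M by (simp add: norm_mult norm_power)
    have upper: "nm ?y \<le> 2 * M ^ p"
    proof (rule nm_least)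
      fix \<psi>' assume \<psi>': "\<psi>' \<in> functionals p"
      have "pair \<psi>' ?y = (\<Sum>j\<in>block p n. (-1) ^ j * \<psi>' j)"
        by (rule pair_unit_sum[OF fin[OF \<psi>']]) simp
      \<comment> \<open>The parameter \<open>1 / M\<close> makes both terms equal to
        \<open>M ^ p\<close>.\<close>
      also have "cmod \<dots> \<le> M ^ Suc p * (1 / M) + 1 / (1 / M) ^ p"
        using gauge_alternating[OF functionals_gauge[OF \<psi>'], of "1 / M" n] M sqrt_size by simp
      also have "\<dots> = 2 * M ^ p" using M by (simp add: power_divide)
      finally show "cmod (pair \<psi>' ?y) \<le> 2 * M ^ p" .
    qed
    have "0 \<le> nm ?y" by (intro nm_nonneg unit_sum_carrier) simp
    then have "C * nm ?y \<le> \<bar>C\<bar> * (2 * M ^ p)" using upper by (intro mult_mono) auto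
    with lower C[of "block p n"] have "M ^ p * M\<^sup>2 \<le> \<bar>C\<bar> * (2 * M ^ p)" by simp
    then have "M ^ p * M\<^sup>2 \<le> M ^ p * (2 * \<bar>C\<bar>)" by (simp add: mult_ac)
    then have "M\<^sup>2 \<le> 2 * \<bar>C\<bar>" using M by simp
    moreover have "2 * \<bar>C\<bar> < M" using n by (simp add: M_def)
    moreover have "M * 1 \<le> M * M" using M by (intro mult_left_mono) auto
    ultimately show False by (simp add: power2_eq_square)
  qed
qed

theorem theorem29:
  fixes \<epsilon> :: real
  assumes "\<epsilon> > 0"
  shows "\<exists>(B :: (real \<Rightarrow> complex) cspace) D A.
           complex_banach_space B \<and> reflexive B \<and>
           closed_operator B D A \<and> densely_defined B D \<and>
           Spec B D A \<subseteq> {z. Re z = 0} \<and>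
           (\<forall>z. Re z \<noteq> 0 \<longrightarrow> operator_norm B (resolvent B D A z) \<le> (1 + \<epsilon>) / \<bar>Re z\<bar>) \<and>
           \<not> (\<exists>T. one_parameter_semigroup B T \<and> generator_of B T D A)"
proof -
  \<comment> \<open>A large \<open>p\<close> means a small interpolation exponent
    \<open>1 / (p + 1)\<close>, for which \<open>1 + pi\<close> raised to it is below
    \<open>1 + \<epsilon>\<close>.\<close>
  obtain p where "1 + pi < (1 + \<epsilon>) ^ p"
    using real_arch_pow[of "1 + \<epsilon>" "1 + pi"] assms by auto
  also have "(1 + \<epsilon>) ^ p \<le> (1 + \<epsilon>) ^ Suc p"
    using assms by (intro power_increasing) auto
  finally have nr: "norming_resolvent (functionals p) (cut p) (1 + \<epsilon>)"
    using assms by (intro norming_resolvent_functionals) auto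
  then interpret norming_resolvent "functionals p" "cut p" "1 + \<epsilon>" .
  show ?thesis
    using banach reflexive_space closed_opA dense_domA Spec_imaginary resolvent_norm not_generator[OF nr]
    by blast
qed

end
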